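(* For every real $p$ with $1<p<\infty$, $N^p$ is a coherent ring; that is, the intersection of any two finitely generated ideals of $N^p$ is a finitely generated ideal of $N^p$.
   Context: $D$ is the open unit disk in $\mathbb{C}$. For $1<p<\infty$, $N^p$ is the ring (under pointwise operations) of holomorphic $f$ on $D$ with $\sup_{0<r<1}\int_0^{2\pi}\big(\log^+|f(re^{i\theta})|\big)^p\,\frac{d\theta}{2\pi}<\infty$, where $\log^+ x=\max(\log x,0)$ for $x\ge 0$ (so $\log^+0=0$). Here a ring is called coherent if the intersection of two finitely generated ideals is finitely generated. *)

theory Defs
  imports "HOL-Complex_Analysis.Complex_Analysis" "HOL-Algebra.Ideal"
begin

definition fin_gen_ideal :: "('a, 'm) ring_scheme \<Rightarrow> 'a set \<Rightarrow> bool" where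
  "fin_gen_ideal R I \<longleftrightarrow> (\<exists>A. A \<subseteq> carrier R \<and> finite A \<and> I = genideal R A)"

locale coherent_ring = cring +
  assumes fin_gen_Int:
    "fin_gen_ideal R I \<Longrightarrow> fin_gen_ideal R J \<Longrightarrow> fin_gen_ideal R (I \<inter> J)"

(* The convention log_plus 0 = 0 holds because ln 0 = 0 for the library's ln. *)
definition log_plus :: "real \<Rightarrow> real" where
  "log_plus x = max (ln x) 0"

(* Functions on the disk are represented by total functions that take the value
   undefined outside it, so that HOL equality is equality on the disk. *)
definition Np :: "real \<Rightarrow> (complex \<Rightarrow> complex) set" where
  "Np p = {f \<in> extensional (ball 0 1). f holomorphic_on ball 0 1 \<and>
     (SUP r\<in>{0<..<1::real}. \<integral>\<^sup>+\<theta>\<in>{0..2*pi}.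
        ennreal (log_plus (cmod (f (of_real r * exp (\<i> * of_real \<theta>)))) powr p / (2*pi)) \<partial>lborel) < \<infinity>}"

definition Np_ring :: "real \<Rightarrow> (complex \<Rightarrow> complex) ring" where
  "Np_ring p =
    \<lparr> carrier = Np p,
      mult = (\<lambda>f g. \<lambda>z\<in>ball 0 1. f z * g z),
      one = (\<lambda>z\<in>ball 0 1. 1),
      zero = (\<lambda>z\<in>ball 0 1. 0),
      add = (\<lambda>f g. \<lambda>z\<in>ball 0 1. f z + g z) \<rparr>"

end

theory Submission
  imports Defs
begin

text \<open>
  An element of \<open>I \<inter> J\<close>, with \<open>I\<close> generated by \<open>A\<close> and \<open>J\<close> by \<open>B\<close>, is a combination of \<open>A\<close>
  that equals a combination of \<open>B\<close>; the coefficients form a syzygy of the family consisting of \<open>A\<close>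
  and \<open>-B\<close>. So coherence follows once the syzygies over \<open>N\<^sup>p\<close> of a finite family \<open>(f i)\<close> of holomorphic
  functions are finitely generated. That rests on three facts.

  The first is a Beurling-Lax decomposition in the Hardy space \<open>H\<^sup>2\<close>, here the space of power series with
  square-summable coefficients. The syzygies with entries in \<open>H\<^sup>2\<close> form a closed space stable under
  multiplication by \<open>z\<close>, and a syzygy whose entries all vanish at 0 is \<open>z\<close> times another syzygy. Hence the
  values at 0 of the syzygies determine them modulo multiples of \<open>z\<close>, and only finitely many \<open>e j\<close>
  are needed to realise these values. Choosing each \<open>e j\<close> of least norm makes it orthogonal to the
  multiples of \<open>z\<close>. Subtracting from a syzygy the combination of the \<open>e j\<close> with the same value at 0,
  dividing by \<open>z\<close> and repeating expands it as \<open>\<Sum>j. h j * e j\<close>; by Pythagoras the coefficients of the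
  power series \<open>h j\<close> are square summable (\<open>syz_finitely_generated\<close>). Working with coefficients
  avoids boundary values altogether.

  The second fact consists of the inclusions \<open>H\<^sup>\<infinity> \<subseteq> H\<^sup>2 \<subseteq> N\<^sup>p\<close>, both from Parseval's identity: a power of the
  logarithm is dominated by a square (\<open>bounded_in_hardy\<close>, \<open>hardy_in_Np\<close>). In particular the \<open>e j\<close> and
  \<open>h j\<close> above belong to \<open>N\<^sup>p\<close> without being known to be bounded.

  The third fact is that every \<open>f\<close> in \<open>N\<^sup>p\<close> becomes bounded after multiplication by some bounded zero-free \<open>G\<close>
  with \<open>1/G\<close> in \<open>N\<^sup>p\<close> (\<open>Np_factor\<close>). On the circle of radius \<open>r\<close> one takes a polynomial \<open>q\<close> whose real
  part exceeds \<open>log\<^sup>+ \<bar>f\<bar>\<close> by at most 1. The maximum principle bounds \<open>f * exp (- q)\<close> by 1, and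
  convexity together with the Poisson formula bounds the means of \<open>(Re q)\<^sup>p\<close> by those of \<open>(1 + log\<^sup>+ \<bar>f\<bar>)\<^sup>p\<close> on
  the circle of radius \<open>r\<close>. A normal-families limit of \<open>exp (- q)\<close> as \<open>r\<close> tends to 1 is the desired \<open>G\<close>.

  Given any syzygy over \<open>N\<^sup>p\<close>, a common \<open>G\<close> makes all its entries bounded, the decomposition in \<open>H\<^sup>2\<close>
  applies to the product, and division by \<open>G\<close> stays within \<open>N\<^sup>p\<close>.
\<close>

section \<open>Square-summable coefficient sequences\<close>

definition square_summable :: "(nat \<Rightarrow> complex) \<Rightarrow> bool" where
  "square_summable x \<longleftrightarrow> summable (\<lambda>k. (cmod (x k))\<^sup>2)"

definition sum_sq :: "(nat \<Rightarrow> complex) \<Rightarrow> real" where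
  "sum_sq x = (\<Sum>k. (cmod (x k))\<^sup>2)"

definition re_ip :: "(nat \<Rightarrow> complex) \<Rightarrow> (nat \<Rightarrow> complex) \<Rightarrow> real" where
  "re_ip x y = (\<Sum>k. Re (x k * cnj (y k)))"

definition pseries :: "(nat \<Rightarrow> complex) \<Rightarrow> complex \<Rightarrow> complex" where
  "pseries x z = (\<Sum>k. x k * z ^ k)"

lemma sum_sq_nonneg: "square_summable x \<Longrightarrow> 0 \<le> sum_sq x"
  unfolding sum_sq_def square_summable_def by (intro suminf_nonneg) auto

lemma sum_sq_coeff: "square_summable x \<Longrightarrow> (cmod (x k))\<^sup>2 \<le> sum_sq x"
  unfolding sum_sq_def square_summable_def using sum_le_suminf[of "\<lambda>k. (cmod (x k))\<^sup>2" "{k}"] by simp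

lemma sum_sq_partial: "square_summable x \<Longrightarrow> (\<Sum>k<K. (cmod (x k))\<^sup>2) \<le> sum_sq x"
  unfolding sum_sq_def square_summable_def by (intro sum_le_suminf) auto

lemma square_summable_bounded_partial:
  assumes "\<And>K. (\<Sum>k<K. (cmod (x k))\<^sup>2) \<le> M"
  shows "square_summable x" "sum_sq x \<le> M"
proof -
  show s: "square_summable x"
    unfolding square_summable_def by (rule summableI_nonneg_bounded[where x=M]) (use assms in auto)
  show "sum_sq x \<le> M"
    unfolding sum_sq_def using s assms unfolding square_summable_def by (intro suminf_le_const) auto
qed

lemma norm_add_power2_le: "(cmod (a + b))\<^sup>2 \<le> 2 * (cmod a)\<^sup>2 + 2 * (cmod b)\<^sup>2"
proof -
  have "(cmod (a + b))\<^sup>2 \<le> (cmod a + cmod b)\<^sup>2"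
    by (intro power_mono norm_triangle_ineq) auto
  also have "\<dots> \<le> 2 * (cmod a)\<^sup>2 + 2 * (cmod b)\<^sup>2"
    using zero_le_power2[of "cmod a - cmod b"] by (simp add: power2_eq_square algebra_simps)
  finally show ?thesis .
qed

lemma square_summable_add: assumes "square_summable x" "square_summable y" shows "square_summable (\<lambda>k. x k + y k)"
  unfolding square_summable_def
proof (rule summable_comparison_test')
  show "summable (\<lambda>k. 2 * (cmod (x k))\<^sup>2 + 2 * (cmod (y k))\<^sup>2)"
    using assms unfolding square_summable_def by (intro summable_add summable_mult)
qed (use norm_add_power2_le in auto)

lemma square_summable_scale: "square_summable x \<Longrightarrow> square_summable (\<lambda>k. a * x k)"
  unfolding square_summable_def by (auto simp: norm_mult power_mult_distrib intro: summable_mult)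

lemma square_summable_0: "square_summable (\<lambda>k. 0)"
  unfolding square_summable_def by simp

lemma square_summable_sum: "(\<And>j. j \<in> J \<Longrightarrow> square_summable (x j)) \<Longrightarrow> square_summable (\<lambda>k. \<Sum>j\<in>J. x j k)"
  by (induction J rule: infinite_finite_induct) (auto intro: square_summable_0 square_summable_add)

lemma square_summable_shift: "square_summable (\<lambda>k. x (Suc k)) \<longleftrightarrow> square_summable x"
  unfolding square_summable_def by (rule summable_Suc_iff)

lemma sum_sq_shift: assumes "square_summable x" shows "sum_sq x = (cmod (x 0))\<^sup>2 + sum_sq (\<lambda>k. x (Suc k))"
  unfolding sum_sq_def using suminf_split_head[of "\<lambda>k. (cmod (x k))\<^sup>2"] assms
  unfolding square_summable_def by simp

lemma re_ip_summable:
  assumes "square_summable x" "square_summable y"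
  shows "summable (\<lambda>k. Re (x k * cnj (y k)))"
proof (rule summable_comparison_test')
  show "summable (\<lambda>k. (cmod (x k))\<^sup>2 + (cmod (y k))\<^sup>2)"
    using assms unfolding square_summable_def by (intro summable_add)
  fix k
  have "\<bar>Re (x k * cnj (y k))\<bar> \<le> cmod (x k) * cmod (y k)"
    by (metis abs_Re_le_cmod complex_mod_cnj norm_mult)
  also have "\<dots> \<le> (cmod (x k))\<^sup>2 + (cmod (y k))\<^sup>2"
    using sum_squares_bound[of "cmod (x k)" "cmod (y k)"]
          mult_nonneg_nonneg[OF norm_ge_zero[of "x k"] norm_ge_zero[of "y k"]] by linarith
  finally show "norm (Re (x k * cnj (y k))) \<le> (cmod (x k))\<^sup>2 + (cmod (y k))\<^sup>2" by simp
qed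

lemma cmod_add_scale_power2: "(cmod (a + of_real t * b))\<^sup>2 = (cmod a)\<^sup>2 + 2 * t * Re (a * cnj b) + t\<^sup>2 * (cmod b)\<^sup>2"
  unfolding cmod_power2 by (simp add: power2_eq_square algebra_simps)

lemma sum_sq_add_scale:
  assumes "square_summable x" "square_summable y"
  shows "sum_sq (\<lambda>k. x k + of_real t * y k) = sum_sq x + 2 * t * re_ip x y + t\<^sup>2 * sum_sq y"
proof -
  have s: "summable (\<lambda>k. (cmod (x k))\<^sup>2)" "summable (\<lambda>k. (cmod (y k))\<^sup>2)"
    using assms by (auto simp: square_summable_def)
  have "(\<lambda>k. (cmod (x k))\<^sup>2 + 2 * t * Re (x k * cnj (y k)) + t\<^sup>2 * (cmod (y k))\<^sup>2)
      sums (sum_sq x + 2 * t * re_ip x y + t\<^sup>2 * sum_sq y)"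
    unfolding sum_sq_def re_ip_def
    by (intro sums_add sums_mult summable_sums s re_ip_summable assms)
  then show ?thesis
    unfolding sum_sq_def cmod_add_scale_power2 by (simp add: sums_iff)
qed

lemma re_ip_scale_left: "re_ip (\<lambda>k. a * x k) y = re_ip x (\<lambda>k. cnj a * y k)"
  unfolding re_ip_def by (simp add: algebra_simps)

lemma re_ip_sum_left:
  assumes "\<And>j. j \<in> J \<Longrightarrow> square_summable (x j)" "square_summable y"
  shows "re_ip (\<lambda>k. \<Sum>j\<in>J. x j k) y = (\<Sum>j\<in>J. re_ip (x j) y)"
  unfolding re_ip_def sum_distrib_right Re_sum
  by (intro suminf_sum re_ip_summable assms)

lemma pseries_summable:
  assumes "\<And>k. cmod (x k) \<le> B" "cmod z < 1"
  shows "summable (\<lambda>k. norm (x k * z ^ k))"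
proof (rule summable_comparison_test')
  show "summable (\<lambda>k. B * cmod z ^ k)"
    using assms(2) by (intro summable_mult summable_geometric) auto
qed (auto simp: norm_mult norm_power intro: mult_right_mono assms)

lemma square_summable_coeff_bound: assumes "square_summable x" shows "cmod (x k) \<le> sqrt (sum_sq x)"
  using sum_sq_coeff[OF assms, of k] by (simp add: real_le_rsqrt)

lemma pseries_sums:
  assumes "square_summable x" "cmod z < 1"
  shows "(\<lambda>k. x k * z ^ k) sums pseries x z"
  unfolding pseries_def using pseries_summable[OF square_summable_coeff_bound[OF assms(1)] assms(2)]
  by (intro summable_sums) (rule summable_norm_cancel)

lemma pseries_bound:
  assumes "\<And>k. cmod (x k) \<le> B" "cmod z < 1"
  shows "cmod (pseries x z) \<le> B / (1 - cmod z)"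
proof -
  have "cmod (pseries x z) \<le> (\<Sum>k. norm (x k * z ^ k))"
    unfolding pseries_def by (intro summable_norm pseries_summable[OF assms])
  also have "\<dots> \<le> (\<Sum>k. B * cmod z ^ k)"
    using assms
    by (intro suminf_le pseries_summable[OF assms] summable_mult summable_geometric)
       (auto simp: norm_mult norm_power intro: mult_right_mono)
  also have "\<dots> = B / (1 - cmod z)"
    using assms(2) by (subst suminf_mult) (auto simp: suminf_geometric summable_geometric)
  finally show ?thesis .
qed

lemma pseries_add: "square_summable x \<Longrightarrow> square_summable y \<Longrightarrow> cmod z < 1 \<Longrightarrow> pseries (\<lambda>k. x k + y k) z = pseries x z + pseries y z"
  using sums_add[OF pseries_sums pseries_sums, of x z y z] by (auto simp: pseries_def sums_iff algebra_simps)

lemma pseries_scale: "square_summable x \<Longrightarrow> cmod z < 1 \<Longrightarrow> pseries (\<lambda>k. a * x k) z = a * pseries x z"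
  using sums_mult[OF pseries_sums, of x z a] by (auto simp: pseries_def sums_iff algebra_simps)

lemma pseries_0: "pseries (\<lambda>k. 0) z = 0"
  by (simp add: pseries_def)

lemma pseries_sum:
  "(\<And>j. j \<in> J \<Longrightarrow> square_summable (x j)) \<Longrightarrow> cmod z < 1 \<Longrightarrow> pseries (\<lambda>k. \<Sum>j\<in>J. x j k) z = (\<Sum>j\<in>J. pseries (x j) z)"
  by (induction J rule: infinite_finite_induct) (auto simp: pseries_0 pseries_add square_summable_sum)

lemma pseries_shift:
  assumes "square_summable x" "cmod z < 1"
  shows "pseries x z = x 0 + z * pseries (\<lambda>k. x (Suc k)) z"
proof -
  have s: "square_summable (\<lambda>k. x (Suc k))"
    using assms square_summable_shift by blast
  have "(\<lambda>k. x (Suc k) * z ^ Suc k) sums (z * pseries (\<lambda>k. x (Suc k)) z)"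
    using sums_mult[OF pseries_sums[OF s assms(2)], of z] by (simp add: algebra_simps)
  then have "(\<lambda>k. x k * z ^ k) sums (z * pseries (\<lambda>k. x (Suc k)) z + x 0)"
    by (subst (asm) sums_Suc_iff) simp
  then show ?thesis
    using pseries_sums[OF assms] by (metis add.commute sums_unique2)
qed

lemma pseries_holomorphic:
  assumes "square_summable x" shows "pseries x holomorphic_on ball 0 1"
  by (rule power_series_holomorphic[where a=x]) (use pseries_sums[OF assms] in auto)

text \<open>
  Bounded coefficientwise convergence gives pointwise convergence in the disk, which is how syzygies
  pass to limits below.
\<close>

lemma pseries_tendsto:
  assumes lim: "\<And>k. (\<lambda>m. X m k) \<longlonglongrightarrow> x k" and B: "\<And>m k. cmod (X m k) \<le> B"
    and z: "cmod z < 1"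
  shows "(\<lambda>m. pseries (X m) z) \<longlonglongrightarrow> pseries x z"
  unfolding pseries_def
proof -
  have "eventually (\<lambda>(k, m). norm (X m k * z ^ k) \<le> B * cmod z ^ k) (at_top \<times>\<^sub>F sequentially)"
    by (intro always_eventually) (auto simp: norm_mult norm_power intro!: mult_right_mono B)
  moreover have "summable (\<lambda>k. B * cmod z ^ k)"
    using z by (intro summable_mult summable_geometric) auto
  moreover have "(\<lambda>m. X m k * z ^ k) \<longlonglongrightarrow> x k * z ^ k" for k
    by (intro tendsto_intros lim)
  ultimately show "(\<lambda>m. \<Sum>k. X m k * z ^ k) \<longlonglongrightarrow> (\<Sum>k. x k * z ^ k)"
    using tannerys_theorem[of "\<lambda>k m. X m k * z ^ k" "\<lambda>k. x k * z ^ k" sequentially "\<lambda>k. B * cmod z ^ k"]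
      sequentially_bot by blast
qed

section \<open>Square-summable syzygies and their generators\<close>

definition total_sq :: "'i set \<Rightarrow> ('i \<Rightarrow> nat \<Rightarrow> complex) \<Rightarrow> real" where
  "total_sq I c = (\<Sum>i\<in>I. sum_sq (c i))"

definition total_re_ip :: "'i set \<Rightarrow> ('i \<Rightarrow> nat \<Rightarrow> complex) \<Rightarrow> ('i \<Rightarrow> nat \<Rightarrow> complex) \<Rightarrow> real" where
  "total_re_ip I c d = (\<Sum>i\<in>I. re_ip (c i) (d i))"

locale syzygies =
  fixes I :: "'i set" and f :: "'i \<Rightarrow> complex \<Rightarrow> complex"
  assumes fin: "finite I" and cont: "\<And>i. i \<in> I \<Longrightarrow> continuous_on (ball 0 1) (f i)"
begin

definition syz :: "('i \<Rightarrow> nat \<Rightarrow> complex) set" where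
  "syz = {c. (\<forall>i\<in>I. square_summable (c i)) \<and> (\<forall>z. cmod z < 1 \<longrightarrow> (\<Sum>i\<in>I. pseries (c i) z * f i z) = 0)}"

lemma syz_square_summable: "c \<in> syz \<Longrightarrow> i \<in> I \<Longrightarrow> square_summable (c i)"
  by (auto simp: syz_def)

lemma syz_0: "(\<lambda>i k. 0) \<in> syz"
  by (auto simp: syz_def square_summable_0 pseries_0)

lemma syz_add:
  assumes "c \<in> syz" "d \<in> syz" shows "(\<lambda>i k. c i k + d i k) \<in> syz"
  using assms unfolding syz_def
  by (auto simp: square_summable_add pseries_add distrib_right sum.distrib)

lemma syz_scale:
  assumes "c \<in> syz" shows "(\<lambda>i k. a * c i k) \<in> syz"
  using assms unfolding syz_def
  by (auto simp: square_summable_scale pseries_scale mult.assoc simp flip: sum_distrib_left)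

lemma syz_diff:
  assumes "c \<in> syz" "d \<in> syz" shows "(\<lambda>i k. c i k - d i k) \<in> syz"
  using syz_add[OF assms(1) syz_scale[OF assms(2), of "-1"]] by simp

lemma syz_sum:
  "(\<And>j. j \<in> J \<Longrightarrow> e j \<in> syz) \<Longrightarrow> (\<lambda>i k. \<Sum>j\<in>J. e j i k) \<in> syz"
  by (induction J rule: infinite_finite_induct) (auto intro: syz_0 syz_add)

text \<open>
  For \<open>z \<noteq> 0\<close> the factor \<open>z\<close> can be cancelled from the relation; at the origin the relation survives
  by continuity.
\<close>

lemma syz_shift:
  assumes c: "c \<in> syz" and c0: "\<And>i. i \<in> I \<Longrightarrow> c i 0 = 0"
  shows "(\<lambda>i k. c i (Suc k)) \<in> syz"
proof -
  define g where "g z = (\<Sum>i\<in>I. pseries (\<lambda>k. c i (Suc k)) z * f i z)" for z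
  have s: "square_summable (\<lambda>k. c i (Suc k))" if "i \<in> I" for i
    using syz_square_summable[OF c that] by (simp add: square_summable_shift)
  have "continuous_on (ball 0 1) g"
    unfolding g_def
    by (intro continuous_intros cont holomorphic_on_imp_continuous_on pseries_holomorphic s)
  then have lim: "g \<midarrow>0\<rightarrow> g 0"
    by (auto simp: continuous_on_eq_continuous_at isCont_def)
  have nz: "g z = 0" if "cmod z < 1" "z \<noteq> 0" for z
  proof -
    have "z * g z = (\<Sum>i\<in>I. pseries (c i) z * f i z)"
      unfolding g_def sum_distrib_left
      by (intro sum.cong) (auto simp: pseries_shift[OF syz_square_summable[OF c] that(1)] c0)
    also have "\<dots> = 0"
      using c that by (auto simp: syz_def)
    finally show ?thesis using that by simp
  qed
  have "g \<midarrow>0\<rightarrow> 0"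
  proof (rule tendsto_eventually)
    have "\<forall>\<^sub>F z in at (0::complex). z \<in> ball 0 1 - {0}"
      by (rule eventually_at_in_open) auto
    then show "\<forall>\<^sub>F z in at 0. g z = 0"
      by eventually_elim (auto intro: nz)
  qed
  with lim have "g 0 = 0"
    by (rule LIM_unique)
  with nz have "g z = 0" if "cmod z < 1" for z
    using that by (cases "z = 0") auto
  then show ?thesis
    using s by (auto simp: syz_def g_def)
qed

lemma total_sq_nonneg: "c \<in> syz \<Longrightarrow> 0 \<le> total_sq I c"
  unfolding total_sq_def by (intro sum_nonneg sum_sq_nonneg syz_square_summable)

lemma sum_sq_le_total_sq: "c \<in> syz \<Longrightarrow> i \<in> I \<Longrightarrow> sum_sq (c i) \<le> total_sq I c"
  unfolding total_sq_def using fin by (intro member_le_sum) (auto intro: sum_sq_nonneg syz_square_summable)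

lemma coeff_le_total_sq: "c \<in> syz \<Longrightarrow> i \<in> I \<Longrightarrow> (cmod (c i k))\<^sup>2 \<le> total_sq I c"
  using sum_sq_le_total_sq sum_sq_coeff[OF syz_square_summable] by (meson order_trans)

lemma total_sq_add_scale:
  assumes "c \<in> syz" "d \<in> syz"
  shows "total_sq I (\<lambda>i k. c i k + of_real t * d i k) = total_sq I c + 2 * t * total_re_ip I c d + t\<^sup>2 * total_sq I d"
proof -
  have "total_sq I (\<lambda>i k. c i k + of_real t * d i k) = (\<Sum>i\<in>I. sum_sq (c i) + 2 * t * re_ip (c i) (d i) + t\<^sup>2 * sum_sq (d i))"
    unfolding total_sq_def using assms by (intro sum.cong sum_sq_add_scale syz_square_summable) auto
  then show ?thesis
    by (simp add: total_sq_def total_re_ip_def sum.distrib sum_distrib_left)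
qed

lemma total_sq_shift:
  assumes "c \<in> syz" "\<And>i. i \<in> I \<Longrightarrow> c i 0 = 0"
  shows "total_sq I (\<lambda>i k. c i (Suc k)) = total_sq I c"
  unfolding total_sq_def using assms by (intro sum.cong) (auto simp: sum_sq_shift[OF syz_square_summable])

text \<open>
  Coefficientwise convergence with convergent norms suffices: every partial sum of squares passes
  to the limit, so the norm is lower semicontinuous.
\<close>

lemma syz_limit:
  assumes C: "\<And>m. C m \<in> syz" and lim: "\<And>i k. i \<in> I \<Longrightarrow> (\<lambda>m. C m i k) \<longlonglongrightarrow> c i k"
    and L: "(\<lambda>m. total_sq I (C m)) \<longlonglongrightarrow> L"
  shows "c \<in> syz" "total_sq I c \<le> L"
proof -
  obtain M where "\<forall>m. \<bar>total_sq I (C m)\<bar> \<le> M"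
    using convergent_imp_Bseq[of "\<lambda>m. total_sq I (C m)"] L
    by (auto simp: convergent_def Bseq_def)
  then have M: "total_sq I (C m) \<le> M" for m
    using abs_le_iff by blast
  have partial: "(\<Sum>k<K. (cmod (c i k))\<^sup>2) \<le> M" if "i \<in> I" for i K
  proof (rule LIMSEQ_le_const2)
    show "(\<lambda>m. \<Sum>k<K. (cmod (C m i k))\<^sup>2) \<longlonglongrightarrow> (\<Sum>k<K. (cmod (c i k))\<^sup>2)"
      by (intro tendsto_intros lim that)
    show "\<exists>N. \<forall>n\<ge>N. (\<Sum>k<K. (cmod (C n i k))\<^sup>2) \<le> M"
      using sum_sq_partial[OF syz_square_summable[OF C that]] sum_sq_le_total_sq[OF C that] M by (meson order_trans)
  qed
  have sqs: "square_summable (c i)" if "i \<in> I" for i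
    by (rule square_summable_bounded_partial[OF partial[OF that]])
  have B: "cmod (C m i k) \<le> sqrt M" if "i \<in> I" for m i k
    using coeff_le_total_sq[OF C that, of m k] M[of m] by (simp add: real_le_rsqrt)
  have "(\<Sum>i\<in>I. pseries (c i) z * f i z) = 0" if z: "cmod z < 1" for z
  proof (rule LIMSEQ_unique)
    show "(\<lambda>m. \<Sum>i\<in>I. pseries (C m i) z * f i z) \<longlonglongrightarrow> (\<Sum>i\<in>I. pseries (c i) z * f i z)"
    proof (intro tendsto_sum tendsto_mult tendsto_const)
      fix i assume "i \<in> I"
      then show "(\<lambda>m. pseries (C m i) z) \<longlonglongrightarrow> pseries (c i) z"
        using lim B by (intro pseries_tendsto[OF _ _ z]) blast+
    qed
    show "(\<lambda>m. \<Sum>i\<in>I. pseries (C m i) z * f i z) \<longlonglongrightarrow> 0"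
      using C z by (auto simp: syz_def)
  qed
  with sqs show "c \<in> syz" by (auto simp: syz_def)
  have "(\<lambda>K. \<Sum>i\<in>I. \<Sum>k<K. (cmod (c i k))\<^sup>2) \<longlonglongrightarrow> total_sq I c"
    unfolding total_sq_def sum_sq_def using sqs unfolding square_summable_def
    by (intro tendsto_sum summable_LIMSEQ) auto
  moreover have "(\<Sum>i\<in>I. \<Sum>k<K. (cmod (c i k))\<^sup>2) \<le> L" for K
  proof (rule LIMSEQ_le[OF _ L])
    show "(\<lambda>m. \<Sum>i\<in>I. \<Sum>k<K. (cmod (C m i k))\<^sup>2) \<longlonglongrightarrow> (\<Sum>i\<in>I. \<Sum>k<K. (cmod (c i k))\<^sup>2)"
      by (intro tendsto_intros lim)
    show "\<exists>N. \<forall>n\<ge>N. (\<Sum>i\<in>I. \<Sum>k<K. (cmod (C n i k))\<^sup>2) \<le> total_sq I (C n)"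
      unfolding total_sq_def by (intro exI allI impI sum_mono sum_sq_partial syz_square_summable[OF C])
  qed
  ultimately show "total_sq I c \<le> L"
    by (intro LIMSEQ_le_const2) auto
qed

text \<open>
  The usual projection argument: by the parallelogram law a minimising sequence is Cauchy in every
  coefficient, and its coefficientwise limit is again a syzygy of no larger norm.
\<close>

lemma minimal_element:
  assumes J: "J \<subseteq> I" and ne: "c0 \<in> syz" "\<And>j. j \<in> J \<Longrightarrow> c0 j 0 = v j"
  obtains e where "e \<in> syz" "\<And>j. j \<in> J \<Longrightarrow> e j 0 = v j"
    "\<And>c. c \<in> syz \<Longrightarrow> (\<And>j. j \<in> J \<Longrightarrow> c j 0 = v j) \<Longrightarrow> total_sq I e \<le> total_sq I c"
proof -
  define T where "T = {c\<in>syz. \<forall>j\<in>J. c j 0 = v j}"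
  define L where "L = Inf (total_sq I ` T)"
  have c0: "c0 \<in> T" using ne by (auto simp: T_def)
  have bdd: "bdd_below (total_sq I ` T)"
    by (rule bdd_belowI[where m=0]) (auto simp: T_def total_sq_nonneg)
  have L: "L \<le> total_sq I c" if "c \<in> T" for c
    unfolding L_def using that bdd by (intro cInf_lower) auto
  have "\<exists>c\<in>T. total_sq I c < L + 1 / (1 + real m)" for m
    using cInf_lessD[of "total_sq I ` T" "L + 1 / (1 + real m)"] c0 by (auto simp: L_def)
  then obtain C where C: "\<And>m. C m \<in> T" "\<And>m. total_sq I (C m) < L + 1 / (1 + real m)"
    by metis
  have CS: "C m \<in> syz" for m using C(1) by (auto simp: T_def)
  have nvC: "(\<lambda>m. total_sq I (C m)) \<longlonglongrightarrow> L"
  proof (rule tendsto_sandwich)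
    show "(\<lambda>m. L) \<longlonglongrightarrow> L" by simp
    show "(\<lambda>m. L + 1 / (1 + real m)) \<longlonglongrightarrow> L"
      using tendsto_add[OF tendsto_const[of L] LIMSEQ_inverse_real_of_nat]
      by (simp add: inverse_eq_divide)
  qed (use C L in \<open>auto intro!: always_eventually less_imp_le\<close>)
  \<comment> \<open>The midpoint of \<open>C m\<close> and \<open>C l\<close> satisfies the same conditions at 0, so its norm is at least \<open>L\<close>.\<close>
  have close: "total_sq I (\<lambda>i k. C m i k - C l i k) \<le> 2 * (total_sq I (C m) - L) + 2 * (total_sq I (C l) - L)" for m l
  proof -
    define d where "d = (\<lambda>i k. C l i k - C m i k)"
    have d: "d \<in> syz" unfolding d_def by (intro syz_diff CS)
    have 1: "total_sq I (C m) + total_re_ip I (C m) d + total_sq I d / 4 \<ge> L"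
    proof -
      have "(\<lambda>i k. C m i k + of_real (1/2) * d i k) \<in> T"
        using syz_add[OF CS[of m] syz_scale[OF d, of "of_real (1/2)"]] C(1)[of m] C(1)[of l]
        by (auto simp: T_def d_def)
      from L[OF this] show ?thesis
        by (subst (asm) total_sq_add_scale[OF CS d]) (simp add: power2_eq_square)
    qed
    have 2: "total_sq I (C l) = total_sq I (C m) + 2 * total_re_ip I (C m) d + total_sq I d"
      using total_sq_add_scale[OF CS d, of m 1] by (simp add: d_def)
    have 3: "total_sq I (\<lambda>i k. C m i k - C l i k) = total_sq I d"
      by (simp add: total_sq_def sum_sq_def d_def norm_minus_commute)
    show ?thesis unfolding 3 using 1 2 by (simp add: field_simps)
  qed
  have "\<exists>e. (\<lambda>m. C m i k) \<longlonglongrightarrow> e" if "i \<in> I" for i k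
  proof -
    have "Cauchy (\<lambda>m. C m i k)"
    proof (rule metric_CauchyI)
      fix r :: real assume r: "0 < r"
      then have "0 < r\<^sup>2 / 4" by simp
      from order_tendstoD(2)[OF nvC, of "L + r\<^sup>2 / 4"] this
      obtain N where N: "\<And>m. m \<ge> N \<Longrightarrow> total_sq I (C m) < L + r\<^sup>2 / 4"
        by (auto simp: eventually_sequentially)
      show "\<exists>N. \<forall>m\<ge>N. \<forall>l\<ge>N. dist (C m i k) (C l i k) < r"
      proof (intro exI allI impI)
        fix m l assume "N \<le> m" "N \<le> l"
        then have "2 * (total_sq I (C m) - L) + 2 * (total_sq I (C l) - L) < r\<^sup>2"
          using N[OF \<open>N \<le> m\<close>] N[OF \<open>N \<le> l\<close>] by argo
        then have "(cmod (C m i k - C l i k))\<^sup>2 < r\<^sup>2"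
          using coeff_le_total_sq[OF syz_diff[OF CS CS] that] close by (meson le_less_trans)
        then show "dist (C m i k) (C l i k) < r"
          using r by (simp add: dist_norm power_less_imp_less_base)
      qed
    qed
    then show ?thesis
      by (simp add: Cauchy_convergent_iff convergent_def)
  qed
  then obtain e where e: "\<And>i k. i \<in> I \<Longrightarrow> (\<lambda>m. C m i k) \<longlonglongrightarrow> e i k"
    by metis
  show thesis
  proof
    show "e \<in> syz" by (rule syz_limit(1)[OF CS e nvC])
    show "e j 0 = v j" if "j \<in> J" for j
    proof (rule LIMSEQ_unique)
      show "(\<lambda>m. C m j 0) \<longlonglongrightarrow> e j 0" using that J by (intro e) auto
      show "(\<lambda>m. C m j 0) \<longlonglongrightarrow> v j" using C(1) that by (auto simp: T_def)
    qed
    show "total_sq I e \<le> total_sq I c" if "c \<in> syz" "\<And>j. j \<in> J \<Longrightarrow> c j 0 = v j" for c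
      using syz_limit(2)[OF CS e nvC] L[of c] that by (auto simp: T_def)
  qed
qed

lemma minimal_imp_orthogonal:
  assumes e: "e \<in> syz" and g: "g \<in> syz" and min: "\<And>t::real. total_sq I e \<le> total_sq I (\<lambda>i k. e i k + of_real t * g i k)"
  shows "total_re_ip I e g = 0"
proof (rule ccontr)
  assume nz: "total_re_ip I e g \<noteq> 0"
  define b n where "b = total_re_ip I e g" and "n = total_sq I g"
  have n: "0 \<le> n" using total_sq_nonneg[OF g] by (simp add: n_def)
  have "0 \<le> 2 * t * b + t\<^sup>2 * n" for t :: real
    using min[of t] unfolding total_sq_add_scale[OF e g] b_def n_def by linarith
  \<comment> \<open>Near the minimiser \<open>- b / n\<close> of the quadratic, but meaningful also for \<open>n = 0\<close>.\<close>
  define s where "s = b / (n + 1)"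
  have b: "b = s * (n + 1)" using n by (simp add: s_def)
  with nz have s: "s \<noteq> 0" by (auto simp: b_def)
  have "0 \<le> 2 * (- s) * b + (- s)\<^sup>2 * n" by fact
  also have "\<dots> = - (s\<^sup>2 * (n + 2))"
    unfolding b by (simp add: power2_eq_square algebra_simps)
  finally have "s\<^sup>2 * (n + 2) \<le> 0" by simp
  moreover have "0 < s\<^sup>2 * (n + 2)" using s n by simp
  ultimately show False by linarith
qed

text \<open>
  The index set \<open>J\<close> picks coordinates that determine the value of a syzygy at 0, and \<open>e\<close> is dual to
  these coordinates: the \<open>e j\<close> at 0 form a reduced echelon basis of the space of all values at 0.
\<close>

definition dual_family :: "'i set \<Rightarrow> ('i \<Rightarrow> 'i \<Rightarrow> nat \<Rightarrow> complex) \<Rightarrow> bool" where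
  "dual_family J e \<longleftrightarrow> J \<subseteq> I \<and> (\<forall>j\<in>J. e j \<in> syz) \<and>
     (\<forall>j\<in>J. \<forall>j'\<in>J. e j j' 0 = (if j' = j then 1 else 0)) \<and>
     (\<forall>c\<in>syz. (\<forall>j\<in>J. c j 0 = 0) \<longrightarrow> (\<forall>i\<in>I. c i 0 = 0))"

lemma dual_familyD:
  assumes "dual_family J e"
  shows "J \<subseteq> I" "\<And>j. j \<in> J \<Longrightarrow> e j \<in> syz"
    "\<And>j j'. j \<in> J \<Longrightarrow> j' \<in> J \<Longrightarrow> e j j' 0 = (if j' = j then 1 else 0)"
    "\<And>c i. c \<in> syz \<Longrightarrow> (\<And>j. j \<in> J \<Longrightarrow> c j 0 = 0) \<Longrightarrow> i \<in> I \<Longrightarrow> c i 0 = 0"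
  using assms unfolding dual_family_def by blast+

text \<open>
  Take a largest \<open>J\<close> that admits dual elements. A syzygy vanishing at 0 on \<open>J\<close> but not at some further
  index could be normalised there and used to clear that coordinate of the others, enlarging \<open>J\<close>.
\<close>

lemma ex_dual_family: "\<exists>J e. dual_family J e"
proof -
  define P where "P J e \<longleftrightarrow> J \<subseteq> I \<and> (\<forall>j\<in>J. e j \<in> syz) \<and>
    (\<forall>j\<in>J. \<forall>j'\<in>J. e j j' 0 = (if j' = j then 1 else 0))"
    for J and e :: "'i \<Rightarrow> 'i \<Rightarrow> nat \<Rightarrow> complex"
  have "P {} (\<lambda>_ _ _. 0)" by (auto simp: P_def)
  moreover have "card J \<le> card I" if "P J e" for J e
    using that fin by (auto simp: P_def card_mono)
  ultimately have "\<exists>J. (\<exists>e. P J e) \<and> (\<forall>J'. (\<exists>e. P J' e) \<longrightarrow> card J' \<le> card J)"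
    by (intro ex_has_greatest_nat[of "\<lambda>J. \<exists>e. P J e" "{}" card "Suc (card I)"])
       (auto simp: less_Suc_eq_le)
  then obtain J where J: "\<exists>e. P J e" and max: "\<And>J'. \<exists>e. P J' e \<Longrightarrow> card J' \<le> card J"
    by blast
  then obtain e where e: "P J e" by blast
  have JI: "J \<subseteq> I" and eS: "\<And>j. j \<in> J \<Longrightarrow> e j \<in> syz"
    and dual: "\<And>j j'. j \<in> J \<Longrightarrow> j' \<in> J \<Longrightarrow> e j j' 0 = (if j' = j then 1 else 0)"
    using e by (auto simp: P_def)
  have finJ: "finite J" using JI fin by (rule finite_subset)
  have "c i 0 = 0" if c: "c \<in> syz" and cJ: "\<And>j. j \<in> J \<Longrightarrow> c j 0 = 0" and i: "i \<in> I" for c i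
    proof (rule ccontr)
      assume nz: "c i 0 \<noteq> 0"
      then have iJ: "i \<notin> J" using cJ by auto
      define b where "b = (\<lambda>i' k. inverse (c i 0) * c i' k)"
      have b: "b \<in> syz" "b i 0 = 1" "\<And>j. j \<in> J \<Longrightarrow> b j 0 = 0"
        using syz_scale[OF c] nz cJ by (auto simp: b_def)
      define e' where "e' = (\<lambda>j. if j = i then b else (\<lambda>i' k. e j i' k - e j i 0 * b i' k))"
      have "P (insert i J) e'"
        unfolding P_def
      proof (intro conjI ballI)
        show "insert i J \<subseteq> I" using i JI by auto
        show "e' j \<in> syz" if "j \<in> insert i J" for j
          using that b(1) syz_diff[OF eS syz_scale[OF b(1)]] by (auto simp: e'_def)
        show "e' j j' 0 = (if j' = j then 1 else 0)" if "j \<in> insert i J" "j' \<in> insert i J" for j j'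
          using that iJ b dual by (auto simp: e'_def)
      qed
      then have "card (insert i J) \<le> card J" using max by blast
      then show False using iJ finJ by simp
    qed
  with JI eS dual have "dual_family J e"
    unfolding dual_family_def by auto
  then show ?thesis by blast
qed

text \<open>
  Replacing each dual element by one of least norm with the same values at 0 on \<open>J\<close> makes it
  orthogonal to every syzygy that vanishes at 0: adding multiples of the latter keeps these values.
\<close>

lemma ex_orthogonal_dual_family:
  "\<exists>J e. dual_family J e \<and> (\<forall>j\<in>J. \<forall>g\<in>syz. (\<forall>j\<in>J. g j 0 = 0) \<longrightarrow> total_re_ip I (e j) g = 0)"
proof -
  obtain J d where Jd: "dual_family J d"
    using ex_dual_family by blast
  note J = dual_familyD(1)[OF Jd] and d = dual_familyD(2,3)[OF Jd]
  have "\<exists>e. e \<in> syz \<and> (\<forall>j'\<in>J. e j' 0 = (if j' = j then 1 else 0)) \<and>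
      (\<forall>c\<in>syz. (\<forall>j'\<in>J. c j' 0 = (if j' = j then 1 else 0)) \<longrightarrow> total_sq I e \<le> total_sq I c)" if "j \<in> J" for j
    by (rule minimal_element[OF J d(1)[OF that], of "\<lambda>j'. if j' = j then 1 else 0"])
       (use d(2) that in auto)
  then obtain e where e: "\<And>j. j \<in> J \<Longrightarrow> e j \<in> syz"
    "\<And>j j'. j \<in> J \<Longrightarrow> j' \<in> J \<Longrightarrow> e j j' 0 = (if j' = j then 1 else 0)"
    "\<And>j c. j \<in> J \<Longrightarrow> c \<in> syz \<Longrightarrow> (\<forall>j'\<in>J. c j' 0 = (if j' = j then 1 else 0)) \<Longrightarrow> total_sq I (e j) \<le> total_sq I c"
    by metis
  have "total_re_ip I (e j) g = 0" if j: "j \<in> J" and g: "g \<in> syz" "\<And>j. j \<in> J \<Longrightarrow> g j 0 = 0" for j g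
  proof (rule minimal_imp_orthogonal[OF e(1)[OF j] g(1)])
    fix t :: real
    show "total_sq I (e j) \<le> total_sq I (\<lambda>i k. e j i k + of_real t * g i k)"
      using e(1)[OF j] e(2)[OF j] g by (intro e(3)[OF j] syz_add syz_scale) auto
  qed
  moreover have "dual_family J e"
    using e(1,2) Jd unfolding dual_family_def by auto
  ultimately show ?thesis by blast
qed

text \<open>
  Each step splits off a combination of the \<open>e j\<close> with the same value at 0 and divides the rest by \<open>z\<close>,
  which gives the coefficients of the multipliers one after the other. The two pieces are orthogonal,
  so the norms of the pieces split off add up to at most the norm of the original syzygy; this makes
  the multipliers square summable and keeps the remainders bounded, hence negligible after
  multiplication by \<open>z ^ n\<close>.
\<close>

theorem syz_finitely_generated:
  obtains J e where "J \<subseteq> I" "\<And>j. j \<in> J \<Longrightarrow> e j \<in> syz"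
    "\<And>c. c \<in> syz \<Longrightarrow> \<exists>h. (\<forall>j\<in>J. square_summable (h j)) \<and>
      (\<forall>i\<in>I. \<forall>z. cmod z < 1 \<longrightarrow> pseries (c i) z = (\<Sum>j\<in>J. pseries (h j) z * pseries (e j i) z))"
proof -
  obtain J e where Je: "dual_family J e"
    and orth': "\<forall>j\<in>J. \<forall>g\<in>syz. (\<forall>j\<in>J. g j 0 = 0) \<longrightarrow> total_re_ip I (e j) g = 0"
    using ex_orthogonal_dual_family by blast
  note J = dual_familyD(1)[OF Je] and eS = dual_familyD(2)[OF Je]
    and dual = dual_familyD(3)[OF Je] and van = dual_familyD(4)[OF Je]
  have orth: "total_re_ip I (e j) g = 0" if "j \<in> J" "g \<in> syz" "\<And>j. j \<in> J \<Longrightarrow> g j 0 = 0" for j g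
    using orth' that by blast
  have finJ: "finite J" using J fin by (rule finite_subset)
  \<comment> \<open>The part \<open>w c\<close> split off, the rest \<open>r c\<close>, which vanishes at 0, and the rest divided by \<open>z\<close>.\<close>
  define w where "w c = (\<lambda>i k. \<Sum>j\<in>J. c j 0 * e j i k)" for c :: "'i \<Rightarrow> nat \<Rightarrow> complex"
  define r where "r c = (\<lambda>i k. c i k - w c i k)" for c
  define N where "N c = (\<lambda>i k. r c i (Suc k))" for c
  have wS: "w c \<in> syz" for c
    unfolding w_def by (intro syz_sum syz_scale eS)
  have wJ: "w c j 0 = c j 0" if "j \<in> J" for c j
  proof -
    have "w c j 0 = (\<Sum>j'\<in>J. if j' = j then c j' 0 else 0)"
      unfolding w_def by (intro sum.cong) (use that in \<open>auto simp: dual\<close>)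
    then show ?thesis using that finJ by simp
  qed
  have rS: "r c \<in> syz" if "c \<in> syz" for c
    unfolding r_def by (intro syz_diff wS that)
  have rJ: "r c j 0 = 0" if "j \<in> J" for c j
    using wJ[OF that] by (simp add: r_def)
  have rI: "r c i 0 = 0" if "c \<in> syz" "i \<in> I" for c i
    using van[OF rS[OF that(1)] rJ that(2)] .
  have NS: "N c \<in> syz" if "c \<in> syz" for c
    unfolding N_def by (intro syz_shift rS rI that)
  \<comment> \<open>The form is only real linear; complex scalars move to \<open>g\<close>, whose multiples are syzygies too.\<close>
  have orth_w: "total_re_ip I (w c) g = 0" if g: "g \<in> syz" "\<And>j. j \<in> J \<Longrightarrow> g j 0 = 0" for c g
  proof -
    have "total_re_ip I (w c) g = (\<Sum>i\<in>I. \<Sum>j\<in>J. re_ip (\<lambda>k. c j 0 * e j i k) (g i))"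
      unfolding total_re_ip_def w_def
      by (intro sum.cong re_ip_sum_left square_summable_scale syz_square_summable[OF eS] syz_square_summable[OF g(1)]) auto
    also have "\<dots> = (\<Sum>j\<in>J. total_re_ip I (e j) (\<lambda>i k. cnj (c j 0) * g i k))"
      unfolding total_re_ip_def re_ip_scale_left by (rule sum.swap)
    also have "\<dots> = 0"
      by (intro sum.neutral ballI orth syz_scale g(1)) (use g(2) in auto)
    finally show ?thesis .
  qed
  have total_sq_step: "total_sq I c = total_sq I (w c) + total_sq I (N c)" if c: "c \<in> syz" for c
  proof -
    have "total_sq I c = total_sq I (\<lambda>i k. w c i k + of_real 1 * r c i k)"
      by (simp add: r_def)
    also have "\<dots> = total_sq I (w c) + total_sq I (r c)"
      using total_sq_add_scale[OF wS rS[OF c], of c 1] orth_w[OF rS[OF c] rJ] by simp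
    also have "total_sq I (r c) = total_sq I (N c)"
      unfolding N_def using total_sq_shift[OF rS[OF c] rI[OF c]] by simp
    finally show ?thesis .
  qed
  have pseries_step: "pseries (c i) z = (\<Sum>j\<in>J. c j 0 * pseries (e j i) z) + z * pseries (N c i) z"
    if c: "c \<in> syz" and i: "i \<in> I" and z: "cmod z < 1" for c i z
  proof -
    have "pseries (c i) z = pseries (\<lambda>k. w c i k + r c i k) z"
      by (simp add: r_def)
    also have "\<dots> = pseries (w c i) z + pseries (r c i) z"
      by (intro pseries_add syz_square_summable[OF wS] syz_square_summable[OF rS[OF c]] i z)
    also have "pseries (w c i) z = (\<Sum>j\<in>J. c j 0 * pseries (e j i) z)"
      unfolding w_def using syz_square_summable[OF eS i] z by (simp add: pseries_sum square_summable_scale pseries_scale)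
    also have "pseries (r c i) z = z * pseries (N c i) z"
      unfolding N_def using pseries_shift[OF syz_square_summable[OF rS[OF c] i] z] rI[OF c i] by simp
    finally show ?thesis .
  qed
  show thesis
  proof (rule that[OF J eS])
    fix c assume c: "c \<in> syz"
    define F where "F n = (N ^^ n) c" for n
    have FS: "F n \<in> syz" for n
      by (induction n) (auto simp: F_def c NS)
    have F_Suc: "F (Suc n) = N (F n)" for n by (simp add: F_def)
    have nvF: "total_sq I c = (\<Sum>m<n. total_sq I (w (F m))) + total_sq I (F n)" for n
    proof (induction n)
      case 0 show ?case by (simp add: F_def)
    next
      case (Suc n)
      then show ?case using total_sq_step[OF FS[of n]] by (simp add: F_Suc)
    qed
    have partial: "(\<Sum>m<n. (cmod (F m j 0))\<^sup>2) \<le> total_sq I c" if j: "j \<in> J" for j n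
    proof -
      have "(\<Sum>m<n. (cmod (F m j 0))\<^sup>2) \<le> (\<Sum>m<n. total_sq I (w (F m)))"
        using coeff_le_total_sq[OF wS, of j _ 0] wJ[OF j] j J by (intro sum_mono) (metis subsetD)
      then show ?thesis
        using nvF[of n] total_sq_nonneg[OF FS[of n]] by linarith
    qed
    have h: "square_summable (\<lambda>n. F n j 0)" if "j \<in> J" for j
      by (rule square_summable_bounded_partial(1)[OF partial[OF that]])
    have nvF_le: "total_sq I (F n) \<le> total_sq I c" for n
      using nvF[of n] total_sq_nonneg[OF wS] sum_nonneg[of "{..<n}" "\<lambda>m. total_sq I (w (F m))"] by simp
    have "pseries (c i) z = (\<Sum>j\<in>J. pseries (\<lambda>n. F n j 0) z * pseries (e j i) z)"
      if i: "i \<in> I" and z: "cmod z < 1" for i z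
    proof -
      have fin_exp: "pseries (c i) z = (\<Sum>j\<in>J. (\<Sum>m<n. F m j 0 * z ^ m) * pseries (e j i) z) + z ^ n * pseries (F n i) z" for n
      proof (induction n)
        case 0 show ?case by (simp add: F_def)
      next
        case (Suc n)
        show ?case
          unfolding Suc.IH pseries_step[OF FS[of n] i z] F_Suc
          by (simp add: algebra_simps sum.distrib sum_distrib_left)
      qed
      have rest: "(\<lambda>n. z ^ n * pseries (F n i) z) \<longlonglongrightarrow> 0"
      proof (rule Lim_null_comparison)
        have "cmod (F n i k) \<le> sqrt (total_sq I c)" for n k
          using coeff_le_total_sq[OF FS i, of n k] nvF_le[of n] by (simp add: real_le_rsqrt)
        then have "cmod (pseries (F n i) z) \<le> sqrt (total_sq I c) / (1 - cmod z)" for n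
          using pseries_bound z by blast
        then show "\<forall>\<^sub>F n in sequentially. norm (z ^ n * pseries (F n i) z) \<le> cmod z ^ n * (sqrt (total_sq I c) / (1 - cmod z))"
          unfolding norm_mult norm_power by (intro always_eventually allI mult_left_mono) auto
        show "(\<lambda>n. cmod z ^ n * (sqrt (total_sq I c) / (1 - cmod z))) \<longlonglongrightarrow> 0"
          using z by (intro tendsto_mult_left_zero LIMSEQ_power_zero) auto
      qed
      have main: "(\<lambda>n. \<Sum>j\<in>J. (\<Sum>m<n. F m j 0 * z ^ m) * pseries (e j i) z)
          \<longlonglongrightarrow> (\<Sum>j\<in>J. pseries (\<lambda>n. F n j 0) z * pseries (e j i) z)"
        using pseries_sums[OF h z] by (intro tendsto_intros) (auto simp: sums_def)
      have "(\<lambda>n. pseries (c i) z) \<longlonglongrightarrow> (\<Sum>j\<in>J. pseries (\<lambda>n. F n j 0) z * pseries (e j i) z)"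
        using tendsto_add[OF main rest] by (simp flip: fin_exp)
      then show ?thesis by (simp add: LIMSEQ_const_iff)
    qed
    with h show "\<exists>h. (\<forall>j\<in>J. square_summable (h j)) \<and>
      (\<forall>i\<in>I. \<forall>z. cmod z < 1 \<longrightarrow> pseries (c i) z = (\<Sum>j\<in>J. pseries (h j) z * pseries (e j i) z))"
      by (intro exI[of _ "\<lambda>j n. F n j 0"]) auto
  qed
qed

end

section \<open>Circle means and the closure properties of N^p\<close>

lemma log_plus_eq: "0 \<le> x \<Longrightarrow> log_plus x = ln (max 1 x)"
  by (cases "x = 0") (auto simp: log_plus_def max_def)

lemma log_plus_nonneg: "0 \<le> log_plus x"
  by (simp add: log_plus_def)

lemma log_plus_cmod_continuous: "continuous_on S g \<Longrightarrow> continuous_on S (\<lambda>t. log_plus (cmod (g t)))"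
  by (auto simp: log_plus_eq intro!: continuous_intros)

lemma log_plus_powr_continuous:
  assumes "continuous_on S g" "0 < p"
  shows "continuous_on S (\<lambda>t. log_plus (cmod (g t)) powr p)"
  using assms by (intro continuous_on_powr' log_plus_cmod_continuous continuous_intros) (auto simp: log_plus_nonneg)

lemma circle_nn_integral:
  fixes F :: "real \<Rightarrow> real"
  assumes "continuous_on {0..2*pi} F" "\<And>t. 0 \<le> F t"
  shows "(\<integral>\<^sup>+t\<in>{0..2*pi}. ennreal (F t) \<partial>lborel) = ennreal (integral {0..2*pi} F)"
proof -
  have "(F has_integral integral {0..2*pi} F) {0..2*pi}"
    using assms by (intro integrable_integral integrable_continuous_real)
  then show ?thesis
    using assms(2) by (intro nn_integral_has_integral_lebesgue') auto
qed

definition log_mean :: "real \<Rightarrow> (complex \<Rightarrow> complex) \<Rightarrow> real \<Rightarrow> real" where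
  "log_mean p f r = integral {0..2*pi} (\<lambda>t. log_plus (cmod (f (of_real r * cis t))) powr p)"

lemma circle_continuous:
  assumes "f holomorphic_on ball 0 1" "\<bar>r\<bar> < 1"
  shows "continuous_on S (\<lambda>t. f (of_real r * cis t))"
proof (rule continuous_on_compose2[OF holomorphic_on_imp_continuous_on[OF assms(1)]])
  show "continuous_on S (\<lambda>t. complex_of_real r * cis t)"
    by (intro continuous_intros)
qed (use assms(2) in \<open>auto simp: norm_mult\<close>)

text \<open>
  On a circle inside the disk the integrand is continuous, so the Lebesgue integral of the
  definition is an ordinary integral; the factor \<open>1 / (2 * pi)\<close> does not affect boundedness.
\<close>

lemma Np_iff:
  assumes p: "0 < p"
  shows "f \<in> Np p \<longleftrightarrow> f \<in> extensional (ball 0 1) \<and> f holomorphic_on ball 0 1 \<and>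
    (\<exists>C. \<forall>r\<in>{0<..<1}. log_mean p f r \<le> C)"
proof (cases "f holomorphic_on ball 0 1")
  case hol: True
  define M where "M r = (\<integral>\<^sup>+\<theta>\<in>{0..2*pi}.
        ennreal (log_plus (cmod (f (of_real r * exp (\<i> * of_real \<theta>)))) powr p / (2*pi)) \<partial>lborel)" for r
  have M: "M r = ennreal (log_mean p f r / (2*pi))" if "r \<in> {0<..<1}" for r
    unfolding M_def log_mean_def using p that hol
    by (subst circle_nn_integral)
       (auto simp flip: cis_conv_exp intro!: continuous_intros log_plus_powr_continuous circle_continuous)
  have "(SUP r\<in>{0<..<1}. M r) < \<infinity> \<longleftrightarrow> (\<exists>C. \<forall>r\<in>{0<..<1}. log_mean p f r \<le> C)"
  proof
    assume "(SUP r\<in>{0<..<1}. M r) < \<infinity>"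
    then obtain B where B: "(SUP r\<in>{0<..<1}. M r) = ennreal B" "0 \<le> B"
      by (cases "SUP r\<in>{0<..<1}. M r" rule: ennreal_cases) auto
    have "log_mean p f r \<le> B * (2*pi)" if r: "r \<in> {0<..<1}" for r
    proof -
      have "ennreal (log_mean p f r / (2*pi)) \<le> ennreal B"
        unfolding M[OF r, symmetric] B(1)[symmetric] by (rule SUP_upper[OF r])
      then show ?thesis
        using B(2) by (simp add: ennreal_le_iff pos_divide_le_eq)
    qed
    then show "\<exists>C. \<forall>r\<in>{0<..<1}. log_mean p f r \<le> C" by blast
  next
    assume "\<exists>C. \<forall>r\<in>{0<..<1}. log_mean p f r \<le> C"
    then obtain C where C: "\<And>r. r \<in> {0<..<1} \<Longrightarrow> log_mean p f r \<le> C" by blast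
    have "(SUP r\<in>{0<..<1}. M r) \<le> ennreal (C / (2*pi))"
      by (intro SUP_least) (auto simp: M intro!: ennreal_leI divide_right_mono C)
    then show "(SUP r\<in>{0<..<1}. M r) < \<infinity>"
      using le_less_trans[OF _ ennreal_less_top] by simp
  qed
  with hol show ?thesis by (simp add: Np_def M_def)
qed (simp add: Np_def)

lemma powr_add_le:
  fixes a b p :: real
  assumes "0 \<le> a" "0 \<le> b" "0 < p"
  shows "(a + b) powr p \<le> 2 powr p * (a powr p + b powr p)"
proof -
  have "(a + b) powr p \<le> (2 * max a b) powr p"
    using assms by (intro powr_mono2) auto
  also have "\<dots> = 2 powr p * max a b powr p"
    using assms by (simp add: powr_mult)
  also have "\<dots> \<le> 2 powr p * (a powr p + b powr p)"
    by (intro mult_left_mono) (auto simp: max_def)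
  finally show ?thesis .
qed

lemma log_mean_integrable:
  assumes "f holomorphic_on ball 0 1" "r \<in> {0<..<1}" "0 < p"
  shows "(\<lambda>t. log_plus (cmod (f (of_real r * cis t))) powr p) integrable_on {0..2*pi}"
  using assms by (intro integrable_continuous_real log_plus_powr_continuous circle_continuous) auto

text \<open>All closure properties of \<open>N\<^sup>p\<close> reduce to a pointwise estimate of this form.\<close>

lemma Np_dominated:
  assumes p: "0 < p" and f: "f \<in> Np p" and g: "g \<in> Np p"
    and h: "h \<in> extensional (ball 0 1)" "h holomorphic_on ball 0 1"
    and dom: "\<And>z. cmod z < 1 \<Longrightarrow>
      log_plus (cmod (h z)) powr p \<le> K * (log_plus (cmod (f z)) powr p + log_plus (cmod (g z)) powr p + 1)"
    and K: "0 \<le> K"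
  shows "h \<in> Np p"
proof -
  obtain C D where C: "\<And>r. r \<in> {0<..<1} \<Longrightarrow> log_mean p f r \<le> C"
    and D: "\<And>r. r \<in> {0<..<1} \<Longrightarrow> log_mean p g r \<le> D"
    and fg: "f holomorphic_on ball 0 1" "g holomorphic_on ball 0 1"
    using f g unfolding Np_iff[OF p] by blast
  have "log_mean p h r \<le> K * (C + D + 2 * pi)" if r: "r \<in> {0<..<1}" for r
  proof -
    have one: "((\<lambda>t. 1::real) has_integral 2 * pi) {0..2*pi}"
      using has_integral_const_real[of "1::real" 0 "2*pi"] by simp
    have "log_mean p h r \<le> integral {0..2*pi} (\<lambda>t. K *
        (log_plus (cmod (f (of_real r * cis t))) powr p + log_plus (cmod (g (of_real r * cis t))) powr p + 1))"
      unfolding log_mean_def using r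
      by (intro integral_le integrable_on_mult_right integrable_add log_mean_integrable p fg h dom)
         (auto simp: norm_mult)
    also have "\<dots> = K * (log_mean p f r + log_mean p g r + 2 * pi)"
      unfolding log_mean_def using r
      by (intro integral_unique has_integral_mult_right has_integral_add integrable_integral
          log_mean_integrable one p fg)
    also have "\<dots> \<le> K * (C + D + 2 * pi)"
      using C[OF r] D[OF r] K by (intro mult_left_mono add_mono) auto
    finally show ?thesis .
  qed
  with h show ?thesis unfolding Np_iff[OF p] by blast
qed

lemma log_plus_mono: "0 \<le> x \<Longrightarrow> x \<le> y \<Longrightarrow> log_plus x \<le> log_plus y"
  by (auto simp: log_plus_eq max_def)

lemma log_plus_mult_le: 
  assumes "0 \<le> x" "0 \<le> y" shows "log_plus (x * y) \<le> log_plus x + log_plus y"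
proof -
  have "max 1 (x * y) \<le> max 1 x * max 1 y"
    using mult_mono[of 1 "max 1 x" 1 "max 1 y"] mult_mono[of x "max 1 x" y "max 1 y"] assms by auto
  then have "ln (max 1 (x * y)) \<le> ln (max 1 x * max 1 y)"
    by (intro ln_mono) auto
  moreover have "max 1 x \<noteq> 0" "max 1 y \<noteq> 0" by (auto simp: max_def)
  ultimately show ?thesis using assms by (simp add: log_plus_eq ln_mult)
qed

lemma log_plus_add_le: 
  assumes "0 \<le> x" "0 \<le> y" shows "log_plus (x + y) \<le> log_plus x + log_plus y + ln 2"
proof -
  have "1 \<le> max 1 x * max 1 y" "max 1 x \<le> max 1 x * max 1 y" "max 1 y \<le> max 1 x * max 1 y"
    using mult_mono[of 1 "max 1 x" 1 "max 1 y"] mult_mono[of "max 1 x" "max 1 x" 1 "max 1 y"]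
      mult_mono[of 1 "max 1 x" "max 1 y" "max 1 y"] by auto
  then have "max 1 (x + y) \<le> 2 * (max 1 x * max 1 y)" by auto
  then have "ln (max 1 (x + y)) \<le> ln (2 * (max 1 x * max 1 y))"
    by (intro ln_mono) auto
  moreover have "max 1 x \<noteq> 0" "max 1 y \<noteq> 0" by (auto simp: max_def)
  ultimately show ?thesis using assms by (simp add: log_plus_eq ln_mult)
qed

lemma Np_const: "0 < p \<Longrightarrow> (\<lambda>z\<in>ball 0 1. c) \<in> Np p"
  unfolding Np_iff
proof (intro conjI exI ballI)
  fix r :: real assume "r \<in> {0<..<1}"
  then show "log_mean p (\<lambda>z\<in>ball 0 1. c) r \<le> 2 * pi * log_plus (cmod c) powr p"
    unfolding log_mean_def by (simp add: norm_mult)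
next
  show "(\<lambda>z\<in>ball 0 1. c) holomorphic_on ball 0 1"
    by (rule holomorphic_transform[of "\<lambda>_. c"]) auto
qed auto

lemma Np_mult:
  assumes p: "0 < p" and f: "f \<in> Np p" and g: "g \<in> Np p"
  shows "(\<lambda>z\<in>ball 0 1. f z * g z) \<in> Np p"
proof (rule Np_dominated[OF p f g, where K="2 powr p"])
  have "(\<lambda>z. f z * g z) holomorphic_on ball 0 1"
    using f g by (intro holomorphic_intros) (auto simp: Np_iff[OF p])
  then show "(\<lambda>z\<in>ball 0 1. f z * g z) holomorphic_on ball 0 1"
    by (rule holomorphic_transform) auto
  fix z :: complex assume z: "cmod z < 1"
  let ?a = "log_plus (cmod (f z))" and ?b = "log_plus (cmod (g z))"
  have "log_plus (cmod ((\<lambda>z\<in>ball 0 1. f z * g z) z)) powr p \<le> (?a + ?b) powr p"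
    using z p by (intro powr_mono2) (auto simp: log_plus_nonneg norm_mult intro: log_plus_mult_le)
  also have "\<dots> \<le> 2 powr p * (?a powr p + ?b powr p)"
    by (intro powr_add_le p log_plus_nonneg)
  also have "\<dots> \<le> 2 powr p * (?a powr p + ?b powr p + 1)" by (intro mult_left_mono) auto
  finally show "log_plus (cmod ((\<lambda>z\<in>ball 0 1. f z * g z) z)) powr p
    \<le> 2 powr p * (?a powr p + ?b powr p + 1)" .
qed auto

lemma Np_add:
  assumes p: "0 < p" and f: "f \<in> Np p" and g: "g \<in> Np p"
  shows "(\<lambda>z\<in>ball 0 1. f z + g z) \<in> Np p"
proof (rule Np_dominated[OF p f g, where K="2 powr p * (2 powr p + 1)"])
  have "(\<lambda>z. f z + g z) holomorphic_on ball 0 1"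
    using f g by (intro holomorphic_intros) (auto simp: Np_iff[OF p])
  then show "(\<lambda>z\<in>ball 0 1. f z + g z) holomorphic_on ball 0 1"
    by (rule holomorphic_transform) auto
  fix z :: complex assume z: "cmod z < 1"
  let ?a = "log_plus (cmod (f z))" and ?b = "log_plus (cmod (g z))"
  have "log_plus (cmod (f z + g z)) \<le> log_plus (cmod (f z) + cmod (g z))"
    by (intro log_plus_mono norm_triangle_ineq) auto
  also have "\<dots> \<le> ?a + ?b + ln 2" by (intro log_plus_add_le) auto
  finally have "log_plus (cmod ((\<lambda>z\<in>ball 0 1. f z + g z) z)) powr p \<le> (?a + ?b + ln 2) powr p"
    using z p by (intro powr_mono2) (auto simp: log_plus_nonneg)
  also have "\<dots> \<le> 2 powr p * ((?a + ?b) powr p + ln 2 powr p)"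
    by (intro powr_add_le p add_nonneg_nonneg log_plus_nonneg) auto
  also have "\<dots> \<le> 2 powr p * (2 powr p * (?a powr p + ?b powr p) + 1)"
    using p ln_2_less_1 powr_mono2[of p "ln 2" 1]
    by (intro mult_left_mono add_mono powr_add_le log_plus_nonneg) auto
  also have "\<dots> \<le> 2 powr p * (2 powr p + 1) * (?a powr p + ?b powr p + 1)"
    by (simp add: algebra_simps)
  finally show "log_plus (cmod ((\<lambda>z\<in>ball 0 1. f z + g z) z)) powr p
    \<le> 2 powr p * (2 powr p + 1) * (?a powr p + ?b powr p + 1)" .
qed auto

lemma Np_sum: "0 < p \<Longrightarrow> (\<And>j. j \<in> J \<Longrightarrow> g j \<in> Np p) \<Longrightarrow> (\<lambda>z\<in>ball 0 1. \<Sum>j\<in>J. g j z) \<in> Np p"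
proof (induction J rule: infinite_finite_induct)
  case (insert j J)
  then have "(\<lambda>z\<in>ball 0 1. g j z + (\<lambda>z\<in>ball 0 1. \<Sum>j\<in>J. g j z) z) \<in> Np p"
    by (intro Np_add) auto
  also have "(\<lambda>z\<in>ball 0 1. g j z + (\<lambda>z\<in>ball 0 1. \<Sum>j\<in>J. g j z) z) = (\<lambda>z\<in>ball 0 1. \<Sum>j\<in>insert j J. g j z)"
    using insert by (auto simp: fun_eq_iff)
  finally show ?case .
qed (use Np_const[of p 0] in auto)

lemma Np_prod: "0 < p \<Longrightarrow> (\<And>j. j \<in> J \<Longrightarrow> g j \<in> Np p) \<Longrightarrow> (\<lambda>z\<in>ball 0 1. \<Prod>j\<in>J. g j z) \<in> Np p"
proof (induction J rule: infinite_finite_induct)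
  case (insert j J)
  then have "(\<lambda>z\<in>ball 0 1. g j z * (\<lambda>z\<in>ball 0 1. \<Prod>j\<in>J. g j z) z) \<in> Np p"
    by (intro Np_mult) auto
  also have "(\<lambda>z\<in>ball 0 1. g j z * (\<lambda>z\<in>ball 0 1. \<Prod>j\<in>J. g j z) z) = (\<lambda>z\<in>ball 0 1. \<Prod>j\<in>insert j J. g j z)"
    using insert by (auto simp: fun_eq_iff)
  finally show ?case .
qed (use Np_const[of p 1] in auto)

section \<open>The Poisson integral and means of positive harmonic functions\<close>

definition poisson :: "complex \<Rightarrow> real \<Rightarrow> real" where
  "poisson w t = (1 - (cmod w)\<^sup>2) / (cmod (cis t - w))\<^sup>2"

lemma poisson_nonneg: "cmod w < 1 \<Longrightarrow> 0 \<le> poisson w t"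
  unfolding poisson_def by (intro divide_nonneg_nonneg) (auto simp: power_le_one)

lemma cis_minus_nonzero: "cmod w < 1 \<Longrightarrow> cis t - w \<noteq> 0"
  using norm_cis[of t] by (auto simp del: norm_cis)

lemma poisson_continuous: "cmod w < 1 \<Longrightarrow> continuous_on S (poisson w)"
  unfolding poisson_def using cis_minus_nonzero by (intro continuous_intros) auto

text \<open>
  This follows from the Cauchy formula at \<open>w\<close> for \<open>H\<close> times a factor that is 1 at \<open>w\<close> and that turns
  the Cauchy kernel into the Poisson kernel on the circle, where \<open>cnj u = 1 / u\<close>.
\<close>

lemma poisson_integral:
  assumes H: "H holomorphic_on UNIV" and w: "cmod w < 1"
  shows "((\<lambda>t. of_real (poisson w t) * H (cis t)) has_integral 2 * of_real pi * H w) {0..2*pi}"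
proof -
  define f where "f u = H u * of_real (1 - (cmod w)\<^sup>2) / (1 - cnj w * u)" for u
  have nz: "1 - cnj w * u \<noteq> 0" if "cmod u \<le> 1" for u
  proof
    assume "1 - cnj w * u = 0"
    then have "cnj w * u = 1" by simp
    then have "cmod w * cmod u = 1" by (metis complex_mod_cnj norm_mult norm_one)
    moreover have "cmod w * cmod u \<le> cmod w" using that by (intro mult_right_le_one_le) auto
    ultimately show False using w by linarith
  qed
  have "f holomorphic_on cball 0 1"
    unfolding f_def using nz by (intro holomorphic_intros holomorphic_on_subset[OF H]) auto
  then have "((\<lambda>u. f u/(u-w)) has_contour_integral (2 * of_real pi * \<i> * f w)) (circlepath 0 1)"
    using w by (intro Cauchy_integral_circlepath_simple) auto
  moreover have "f w = H w"
  proof -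
    have "of_real (1 - (cmod w)\<^sup>2) = 1 - cnj w * w"
      unfolding of_real_diff complex_norm_square by simp
    then show ?thesis using nz[of w] w by (simp add: f_def)
  qed
  ultimately have "((\<lambda>t. f (cis t) / (cis t - w) * \<i> * cis t) has_integral 2 * of_real pi * \<i> * H w) {0..2*pi}"
    unfolding circlepath_def by (subst (asm) has_contour_integral_part_circlepath_iff) auto
  from has_integral_mult_right[OF this, of "-\<i>"]
  have "((\<lambda>t. - \<i> * (f (cis t) / (cis t - w) * \<i> * cis t)) has_integral 2 * of_real pi * H w) {0..2*pi}"
    by (simp add: algebra_simps)
  moreover have "- \<i> * (f (cis t) / (cis t - w) * \<i> * cis t) = of_real (poisson w t) * H (cis t)" for t
  proof -
    have 1: "1 - cnj w * cis t = cis t * cnj (cis t - w)"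
      by (simp add: algebra_simps flip: complex_norm_square)
    have 2: "complex_of_real ((cmod (cis t - w))\<^sup>2) = (cis t - w) * cnj (cis t - w)"
      by (simp only: complex_norm_square)
    have nzc: "cis t \<noteq> 0" "cis t - w \<noteq> 0" "cnj (cis t - w) \<noteq> 0"
      using cis_minus_nonzero[OF w, of t] by (auto simp del: complex_cnj_diff)
    show ?thesis
      unfolding f_def poisson_def 1 of_real_divide 2 using nzc
      by (simp add: field_simps del: complex_cnj_diff)
  qed
  ultimately show ?thesis by simp
qed

lemma poisson_integral_Re:
  assumes H: "H holomorphic_on UNIV" and w: "cmod w < 1"
  shows "((\<lambda>t. poisson w t * Re (H (cis t))) has_integral 2 * pi * Re (H w)) {0..2*pi}"
  using has_integral_Re[OF poisson_integral[OF assms]] by simp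

lemma powr_above_tangent:
  fixes x y p :: real
  assumes "1 \<le> p" "0 \<le> x" "0 < y"
  shows "y powr p + p * y powr (p - 1) * (x - y) \<le> x powr p"
proof (cases "x = 0")
  case True
  have "y powr p + p * y powr (p - 1) * (x - y) = (1 - p) * y powr p"
    using assms True by (simp add: powr_diff field_simps)
  also have "\<dots> \<le> 0" using assms by (intro mult_nonpos_nonneg) auto
  finally show ?thesis using True by simp
next
  case False
  have "x powr p - y powr p \<ge> p * y powr (p - 1) * (x - y)"
  proof (rule convex_on_imp_above_tangent[OF powr_convex[OF assms(1)]])
    show "((\<lambda>x. x powr p) has_real_derivative p * y powr (p - 1)) (at y within {0<..})"
      using assms by (auto intro!: derivative_eq_intros)
  qed (use assms False in \<open>auto simp: interior_open\<close>)
  then show ?thesis by simp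
qed

lemma Re_powr_continuous:
  assumes H: "H holomorphic_on UNIV" and p: "1 \<le> p" and g: "continuous_on S g"
    and nonneg: "\<And>t. t \<in> S \<Longrightarrow> 0 \<le> Re (H (g t))"
  shows "continuous_on S (\<lambda>t. Re (H (g t)) powr p)"
proof -
  have "continuous_on S (\<lambda>t. H (g t))"
    by (rule continuous_on_compose2[OF holomorphic_on_imp_continuous_on[OF H] g]) auto
  then show ?thesis
    using p nonneg by (intro continuous_on_powr' continuous_intros) auto
qed

text \<open>
  Jensen's inequality for the Poisson kernel, which is a probability density up to the factor
  \<open>2 * pi\<close>: integrate the tangent-line inequality of the convex power function at the mean value.
\<close>

lemma poisson_jensen:
  assumes H: "H holomorphic_on UNIV" and w: "cmod w < 1" and p: "1 \<le> p"
    and nonneg: "\<And>t. 0 \<le> Re (H (cis t))"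
  shows "0 \<le> Re (H w)" 
    "2 * pi * Re (H w) powr p \<le> integral {0..2*pi} (\<lambda>t. poisson w t * Re (H (cis t)) powr p)"
proof -
  let ?y = "Re (H w)"
  have "0 \<le> 2 * pi * ?y"
    by (rule has_integral_nonneg[OF poisson_integral_Re[OF H w]])
       (auto intro!: mult_nonneg_nonneg poisson_nonneg w nonneg)
  then show y: "0 \<le> ?y" using pi_gt_zero by (auto simp: zero_le_mult_iff)
  have cont: "continuous_on {0..2*pi} (\<lambda>t. poisson w t * Re (H (cis t)) powr p)"
    by (intro continuous_intros poisson_continuous w Re_powr_continuous[OF H p] nonneg)
  show "2 * pi * ?y powr p \<le> integral {0..2*pi} (\<lambda>t. poisson w t * Re (H (cis t)) powr p)"
  proof (cases "?y = 0")
    case True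
    then show ?thesis
      by (auto intro!: integral_nonneg integrable_continuous_real cont mult_nonneg_nonneg poisson_nonneg w)
  next
    case False
    with y have y: "0 < ?y" by simp
    let ?a = "?y powr p - p * ?y powr (p - 1) * ?y" and ?b = "p * ?y powr (p - 1)"
    have "((\<lambda>t. ?a * (poisson w t * Re 1) + ?b * (poisson w t * Re (H (cis t))))
        has_integral ?a * (2 * pi * Re 1) + ?b * (2 * pi * ?y)) {0..2*pi}"
      by (intro has_integral_add has_integral_mult_right poisson_integral_Re[OF _ w] H
          poisson_integral_Re[of "\<lambda>_. 1", OF _ w]) auto
    moreover have "((\<lambda>t. poisson w t * Re (H (cis t)) powr p) has_integral
        integral {0..2*pi} (\<lambda>t. poisson w t * Re (H (cis t)) powr p)) {0..2*pi}"
      by (intro integrable_integral integrable_continuous_real cont)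
    ultimately have "?a * (2 * pi * Re 1) + ?b * (2 * pi * ?y)
        \<le> integral {0..2*pi} (\<lambda>t. poisson w t * Re (H (cis t)) powr p)"
    proof (rule has_integral_le)
      fix t
      have "poisson w t * (?y powr p + ?b * (Re (H (cis t)) - ?y)) \<le> poisson w t * Re (H (cis t)) powr p"
        by (intro mult_left_mono powr_above_tangent p nonneg y poisson_nonneg w)
      then show "?a * (poisson w t * Re 1) + ?b * (poisson w t * Re (H (cis t)))
          \<le> poisson w t * Re (H (cis t)) powr p"
        by (simp add: algebra_simps)
    qed
    then show ?thesis by (simp add: algebra_simps)
  qed
qed

lemma poisson_symmetric:
  "poisson (of_real r * cis s) t = poisson (of_real r * cis t) s"
proof -
  have "cmod (cis t - of_real r * cis s) = cmod (cis s - of_real r * cis t)"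
  proof -
    have "cis s - of_real r * cis t = cis s * cis t * cnj (cis t - of_real r * cis s)"
      by (simp add: algebra_simps cis_mult cis_cnj)
    then show ?thesis by (simp add: norm_mult del: complex_cnj_diff)
  qed
  then show ?thesis by (simp add: poisson_def norm_mult)
qed

text \<open>
  Integrate the Jensen inequality over the smaller circle and exchange the integrals. By symmetry of
  the kernel in the two angles its integral over the smaller circle is again \<open>2 * pi\<close>.
\<close>

lemma circle_mean_Re_powr_le:
  assumes H: "H holomorphic_on UNIV" and r: "0 \<le> r" "r < 1" and p: "1 \<le> p"
    and nonneg: "\<And>t. 0 \<le> Re (H (cis t))"
  shows "integral {0..2*pi} (\<lambda>s. Re (H (of_real r * cis s)) powr p)
      \<le> integral {0..2*pi} (\<lambda>t. Re (H (cis t)) powr p)"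
proof -
  let ?U = "\<lambda>t. Re (H (cis t)) powr p"
  have w: "cmod (of_real r * cis s) < 1" for s
    using r by (simp add: norm_mult)
  have contU: "continuous_on S ?U" for S
    by (intro continuous_intros Re_powr_continuous[OF H p] nonneg)
  have cont1: "continuous_on S (\<lambda>s. Re (H (of_real r * cis s)) powr p)" for S
    by (intro continuous_intros Re_powr_continuous[OF H p] poisson_jensen(1)[OF H w p nonneg])
  have cont2: "continuous_on S (\<lambda>(s,t). poisson (of_real r * cis s) t * ?U t)" for S
  proof -
    have "continuous_on S (\<lambda>x. poisson (of_real r * cis (fst x)) (snd x))"
      unfolding poisson_def using cis_minus_nonzero[OF w] by (intro continuous_intros) auto
    then show ?thesis
      unfolding split_beta
      by (intro continuous_on_mult continuous_intros Re_powr_continuous[OF H p] nonneg)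
  qed
  have sw: "integral {0..2*pi} (\<lambda>s. integral {0..2*pi} (\<lambda>t. poisson (of_real r * cis s) t * ?U t))
      = integral {0..2*pi} (\<lambda>t. integral {0..2*pi} (\<lambda>s. poisson (of_real r * cis s) t * ?U t))"
    using integral_swap_continuous[OF cont2] by (simp add: cbox_interval)
  have inner: "integral {0..2*pi} (\<lambda>s. poisson (of_real r * cis s) t * ?U t) = 2 * pi * ?U t" for t
  proof -
    have "((\<lambda>s. poisson (of_real r * cis t) s * Re 1) has_integral 2 * pi * Re 1) {0..2*pi}"
      by (rule poisson_integral_Re[of "\<lambda>_. 1", OF _ w]) auto
    from has_integral_mult_left[OF this, of "?U t"]
    have "((\<lambda>s. poisson (of_real r * cis s) t * ?U t) has_integral 2 * pi * ?U t) {0..2*pi}"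
      unfolding poisson_symmetric[of r _ t] by simp
    then show ?thesis by (rule integral_unique)
  qed
  have "2 * pi * integral {0..2*pi} (\<lambda>s. Re (H (of_real r * cis s)) powr p)
      = integral {0..2*pi} (\<lambda>s. 2 * pi * Re (H (of_real r * cis s)) powr p)"
    by simp
  also have "\<dots> \<le> integral {0..2*pi} (\<lambda>s. integral {0..2*pi} (\<lambda>t. poisson (of_real r * cis s) t * ?U t))"
  proof (rule integral_le)
    show "(\<lambda>s. integral {0..2*pi} (\<lambda>t. poisson (of_real r * cis s) t * ?U t)) integrable_on {0..2*pi}"
      using integral_integrable_2dim[of 0 0 "2*pi" "2*pi" "\<lambda>(s, t). poisson (of_real r * cis s) t * ?U t", OF cont2]
      by (simp add: cbox_interval)
  qed (auto intro!: integrable_continuous_real continuous_intros cont1 poisson_jensen(2)[OF H w p nonneg])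
  also have "\<dots> = 2 * pi * integral {0..2*pi} ?U"
    unfolding sw inner by simp
  finally show ?thesis by simp
qed

section \<open>Real parts of polynomials on the circle\<close>

text \<open>
  On the unit circle \<open>a * z\<close> to a negative power is the conjugate of \<open>cnj a * z\<close> to the opposite power
  and has the same real part, so negative powers can be traded for positive ones.
\<close>

lemma laurent_real_part:
  "\<exists>q'. \<forall>z\<in>sphere 0 1. Re (poly q z / z ^ N) = Re (poly q' z)"
proof (induction N arbitrary: q)
  case 0
  then show ?case by auto
next
  case (Suc N)
  obtain a r where q: "q = pCons a r" by (cases q)
  obtain r' where r': "\<And>z. z \<in> sphere 0 1 \<Longrightarrow> Re (poly r z / z ^ N) = Re (poly r' z)"
    using Suc by blast
  have "Re (poly q z / z ^ Suc N) = Re (poly (monom (cnj a) (Suc N) + r') z)" if z: "z \<in> sphere 0 1" for z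
  proof -
    have nz: "z \<noteq> 0" using z by auto
    define y where "y = z ^ Suc N"
    have "cmod y = 1" using z by (simp add: y_def norm_mult norm_power)
    then have y: "y * cnj y = 1" using complex_norm_square[of y] by simp
    have "Re (poly q z / z ^ Suc N) = Re (a / y) + Re (poly r z / z ^ N)"
      using nz by (simp add: q y_def add_divide_distrib)
    also have "a / y = a * cnj y"
    proof -
      have "a / y = a * (y * cnj y) / y" unfolding y by simp
      also have "\<dots> = a * cnj y" using nz by (simp add: y_def)
      finally show ?thesis .
    qed
    also have "Re (a * cnj y) = Re (cnj a * y)" by simp
    finally show ?thesis
      using r'[OF z] by (simp add: y_def poly_monom)
  qed
  then show ?case by blast
qed

text \<open>
  The real functions on the circle of the form \<open>poly q z / z ^ N\<close> are the real trigonometric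
  polynomials; unlike real parts of polynomials they visibly form a ring, so Stone-Weierstrass applies.
  Approximating \<open>u + 1/2\<close> within \<open>1/2\<close> yields a one-sided approximation of \<open>u\<close>.
\<close>

lemma circle_real_part_approx:
  fixes u :: "complex \<Rightarrow> real"
  assumes "continuous_on (sphere 0 1) u"
  obtains q where "\<And>z. z \<in> sphere 0 1 \<Longrightarrow> u z \<le> Re (poly q z)" "\<And>z. z \<in> sphere 0 1 \<Longrightarrow> Re (poly q z) \<le> u z + 1"
proof -
  define P where "P g \<longleftrightarrow> (\<exists>N q. \<forall>z\<in>sphere 0 1. complex_of_real (g z) = poly q z / z ^ N)" for g
  have nz: "z \<noteq> 0" if "z \<in> sphere 0 1" for z :: complex using that by auto
  have PI: "P g" if "\<And>z. z \<in> sphere 0 1 \<Longrightarrow> complex_of_real (g z) = poly q z / z ^ N" for g q N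
    using that unfolding P_def by blast
  have "\<exists>g. P g \<and> (\<forall>z\<in>sphere 0 1. \<bar>(u z + 1/2) - g z\<bar> < 1/2)"
  proof (rule Stone_Weierstrass_HOL)
    show "P (\<lambda>z. c)" for c
      by (rule PI[where q="[:of_real c:]" and N=0]) auto
    show "continuous_on (sphere 0 1) g" if Pg: "P g" for g
    proof -
      obtain N q where g: "\<forall>z\<in>sphere 0 1. complex_of_real (g z) = poly q z / z ^ N"
        using Pg unfolding P_def by blast
      show ?thesis
      proof (rule continuous_on_eq)
        show "continuous_on (sphere 0 1) (\<lambda>z. Re (poly q z / z ^ N))"
          using nz by (intro continuous_intros) auto
        show "Re (poly q z / z ^ N) = g z" if "z \<in> sphere 0 1" for z
          using g that by (metis Re_complex_of_real)
      qed
    qed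
    show "P (\<lambda>z. g z + h z)" "P (\<lambda>z. g z * h z)" if gh: "P g \<and> P h" for g h
    proof -
      obtain N q M r where g: "\<forall>z\<in>sphere 0 1. complex_of_real (g z) = poly q z / z ^ N"
        and h: "\<forall>z\<in>sphere 0 1. complex_of_real (h z) = poly r z / z ^ M"
        using gh unfolding P_def by blast
      show "P (\<lambda>z. g z + h z)"
        by (rule PI[where q="q * monom 1 M + r * monom 1 N" and N="N + M"])
           (use g h nz in \<open>auto simp: poly_monom power_add field_simps\<close>)
      show "P (\<lambda>z. g z * h z)"
        by (rule PI[where q="q * r" and N="N + M"])
           (use g h in \<open>auto simp: power_add field_simps\<close>)
    qed
    show "\<exists>g. P g \<and> g x \<noteq> g y" if xy: "x \<in> sphere 0 1 \<and> y \<in> sphere 0 1 \<and> x \<noteq> y" for x y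
    proof -
      have inv: "1 / z = cnj z" if "z \<in> sphere 0 1" for z
        using that nz[OF that] by (auto simp: field_simps simp flip: complex_norm_square)
      have "P Re"
      proof (rule PI[where q="[:1/2, 0, 1/2:]" and N=1])
        fix z :: complex assume z: "z \<in> sphere 0 1"
        have "complex_of_real (Re z) = (z + 1 / z) / 2"
          unfolding inv[OF z] by (simp add: complex_eq_iff)
        then show "complex_of_real (Re z) = poly [:1/2, 0, 1/2:] z / z ^ 1"
          using nz[OF z] by (simp add: field_simps)
      qed
      moreover have "P Im"
      proof (rule PI[where q="[:\<i>/2, 0, -\<i>/2:]" and N=1])
        fix z :: complex assume z: "z \<in> sphere 0 1"
        have "complex_of_real (Im z) = - \<i> * (z - 1 / z) / 2"
          unfolding inv[OF z] by (simp add: complex_eq_iff)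
        then show "complex_of_real (Im z) = poly [:\<i>/2, 0, -\<i>/2:] z / z ^ 1"
          using nz[OF z] by (simp add: field_simps)
      qed
      moreover have "Re x \<noteq> Re y \<or> Im x \<noteq> Im y" using xy by (auto simp: complex_eq_iff)
      ultimately show ?thesis by blast
    qed
  qed (auto intro!: continuous_intros assms)
  then obtain g where "P g" and g: "\<And>z. z \<in> sphere 0 1 \<Longrightarrow> \<bar>(u z + 1/2) - g z\<bar> < 1/2" by blast
  then obtain N q where q: "\<And>z. z \<in> sphere 0 1 \<Longrightarrow> complex_of_real (g z) = poly q z / z ^ N"
    unfolding P_def by blast
  obtain q' where q': "\<And>z. z \<in> sphere 0 1 \<Longrightarrow> Re (poly q z / z ^ N) = Re (poly q' z)"
    using laurent_real_part by blast
  have "Re (poly q' z) = g z" if "z \<in> sphere 0 1" for z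
    using q[OF that] q'[OF that] by (metis Re_complex_of_real)
  then show thesis
    using g by (intro that[of q']) (smt (verit) abs_less_iff field_sum_of_halves)+
qed

section \<open>Elements of N^p as quotients of bounded functions\<close>

text \<open>
  After rescaling the circle of radius \<open>r\<close> to the unit circle, the real part of \<open>q\<close> is chosen between
  \<open>log\<^sup>+ \<bar>f\<bar>\<close> and \<open>log\<^sup>+ \<bar>f\<bar> + 1\<close>. The lower bound feeds the maximum principle, the upper bound the
  estimate of the means, which does not depend on \<open>r\<close>.
\<close>

lemma Np_approx_factor:
  assumes p: "1 \<le> p" and f: "f holomorphic_on ball 0 1" and r: "0 < r" "r < 1"
    and C: "log_mean p f r \<le> C"
  obtains q where "\<And>z. cmod z < 1 \<Longrightarrow> 0 \<le> Re (poly q z)"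
    "\<And>z. cmod z < 1 \<Longrightarrow> cmod (f (of_real r * z) * exp (- poly q z)) \<le> 1"
    "\<And>s. 0 \<le> s \<Longrightarrow> s < 1 \<Longrightarrow>
      integral {0..2*pi} (\<lambda>t. Re (poly q (of_real s * cis t)) powr p) \<le> 2 powr p * (C + 2 * pi)"
proof -
  have rz: "cmod (of_real r * z) < 1" if "cmod z \<le> 1" for z
  proof -
    have "r * cmod z \<le> r" using that r by (intro mult_right_le_one_le) auto
    moreover have "cmod (of_real r * z) = r * cmod z" using r by (simp add: norm_mult)
    ultimately show ?thesis using r by linarith
  qed
  have fr: "(\<lambda>z. f (of_real r * z)) holomorphic_on cball 0 1"
    using rz by (intro holomorphic_on_compose_gen[OF _ f, unfolded o_def] holomorphic_intros) auto
  have "continuous_on (sphere 0 1) (\<lambda>z. log_plus (cmod (f (of_real r * z))))"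
    by (intro log_plus_cmod_continuous holomorphic_on_imp_continuous_on holomorphic_on_subset[OF fr]) auto
  from circle_real_part_approx[OF this]
  obtain q where q: "\<And>z. z \<in> sphere 0 1 \<Longrightarrow> log_plus (cmod (f (of_real r * z))) \<le> Re (poly q z)"
    "\<And>z. z \<in> sphere 0 1 \<Longrightarrow> Re (poly q z) \<le> log_plus (cmod (f (of_real r * z))) + 1"
    by blast
  have H: "poly q holomorphic_on S" for S
    by (intro holomorphic_intros) 
  have nonneg: "0 \<le> Re (poly q (cis t))" for t
    using q(1)[of "cis t"] log_plus_nonneg[of "cmod (f (of_real r * cis t))"] by simp
  show thesis
  proof (rule that)
    show "0 \<le> Re (poly q z)" if "cmod z < 1" for z
      by (rule poisson_jensen(1)[OF H that p nonneg])
    show "cmod (f (of_real r * z) * exp (- poly q z)) \<le> 1" if "cmod z < 1" for z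
    proof (rule maximum_modulus_frontier[of "\<lambda>z. f (of_real r * z) * exp (- poly q z)" "cball 0 1"])
      have hol: "(\<lambda>z. f (of_real r * z) * exp (- poly q z)) holomorphic_on cball 0 1"
        by (intro holomorphic_intros fr H)
      then show "(\<lambda>z. f (of_real r * z) * exp (- poly q z)) holomorphic_on interior (cball 0 1)"
        "continuous_on (closure (cball 0 1)) (\<lambda>z. f (of_real r * z) * exp (- poly q z))"
        by (auto intro: holomorphic_on_imp_continuous_on holomorphic_on_subset[OF hol])
      fix z :: complex assume "z \<in> frontier (cball 0 1)"
      then have z: "z \<in> sphere 0 1" by simp
      let ?x = "cmod (f (of_real r * z))"
      have "?x \<le> exp (log_plus ?x)"
        by (auto simp: log_plus_eq)
      also have "\<dots> \<le> exp (Re (poly q z))" using q(1)[OF z] by simp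
      finally show "cmod (f (of_real r * z) * exp (- poly q z)) \<le> 1"
        unfolding norm_mult norm_exp_eq_Re by (simp add: exp_minus divide_simps)
    qed (use that in auto)
    show "integral {0..2*pi} (\<lambda>t. Re (poly q (of_real s * cis t)) powr p) \<le> 2 powr p * (C + 2 * pi)"
      if s: "0 \<le> s" "s < 1" for s
    proof -
      have "integral {0..2*pi} (\<lambda>t. Re (poly q (of_real s * cis t)) powr p)
          \<le> integral {0..2*pi} (\<lambda>t. Re (poly q (cis t)) powr p)"
        by (rule circle_mean_Re_powr_le[OF H s p nonneg])
      also have "\<dots> \<le> 2 powr p * (log_mean p f r + 2 * pi)"
      proof (rule has_integral_le)
        show "((\<lambda>t. Re (poly q (cis t)) powr p) has_integral integral {0..2*pi} (\<lambda>t. Re (poly q (cis t)) powr p)) {0..2*pi}"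
          by (intro integrable_integral integrable_continuous_real Re_powr_continuous[OF H p] nonneg continuous_intros)
        have one: "((\<lambda>t. 1::real) has_integral 2 * pi) {0..2*pi}"
          using has_integral_const_real[of "1::real" 0 "2*pi"] by simp
        show "((\<lambda>t. 2 powr p * (log_plus (cmod (f (of_real r * cis t))) powr p + 1))
            has_integral 2 powr p * (log_mean p f r + 2 * pi)) {0..2*pi}"
          unfolding log_mean_def using r p
          by (intro has_integral_mult_right has_integral_add integrable_integral log_mean_integrable f one) auto
        fix t
        let ?u = "log_plus (cmod (f (of_real r * cis t)))"
        have "Re (poly q (cis t)) powr p \<le> (?u + 1) powr p"
          using q(2)[of "cis t"] nonneg p by (intro powr_mono2) auto
        also have "\<dots> \<le> 2 powr p * (?u powr p + 1 powr p)"
          using p by (intro powr_add_le log_plus_nonneg) auto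
        finally show "Re (poly q (cis t)) powr p \<le> 2 powr p * (?u powr p + 1)" by simp
      qed
      also have "\<dots> \<le> 2 powr p * (C + 2 * pi)"
        using C by (intro mult_left_mono) auto
      finally show ?thesis .
    qed
  qed
qed

text \<open>
  The functions \<open>exp (- q)\<close> belonging to radii that tend to 1 are bounded by 1 and zero-free.
  The bound on the means of \<open>(Re q)\<^sup>p\<close>, taken at the centre, keeps the limit \<open>G\<close> from vanishing at 0, hence
  everywhere by Hurwitz; taken on a circle, it passes to \<open>log\<^sup>+ \<bar>1 / G\<bar>\<close> by Fatou's lemma.
\<close>

theorem Np_factor:
  assumes p: "1 \<le> p" and f: "f \<in> Np p"
  obtains G where "G holomorphic_on ball 0 1" "\<And>z. cmod z < 1 \<Longrightarrow> G z \<noteq> 0"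
    "\<And>z. cmod z < 1 \<Longrightarrow> cmod (G z) \<le> 1" "\<And>z. cmod z < 1 \<Longrightarrow> cmod (f z * G z) \<le> 1"
    "(\<lambda>z\<in>ball 0 1. 1 / G z) \<in> Np p"
proof -
  have p0: "0 < p" using p by simp
  obtain C where f: "f holomorphic_on ball 0 1" and C: "\<And>r. r \<in> {0<..<1} \<Longrightarrow> log_mean p f r \<le> C"
    using f unfolding Np_iff[OF p0] by blast
  define r where "r m = 1 - inverse (real (Suc (Suc m)))" for m
  have r: "0 < r m" "r m < 1" for m
    by (auto simp: r_def field_simps)
  have rlim: "r \<longlonglongrightarrow> 1"
    unfolding r_def using tendsto_diff[OF tendsto_const LIMSEQ_Suc[OF LIMSEQ_inverse_real_of_nat], of 1] by simp
  define M where "M = 2 powr p * (C + 2 * pi)"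
  have "\<exists>q. (\<forall>z. cmod z < 1 \<longrightarrow> 0 \<le> Re (poly q z)) \<and>
    (\<forall>z. cmod z < 1 \<longrightarrow> cmod (f (of_real (r m) * z) * exp (- poly q z)) \<le> 1) \<and>
    (\<forall>s. 0 \<le> s \<and> s < 1 \<longrightarrow> integral {0..2*pi} (\<lambda>t. Re (poly q (of_real s * cis t)) powr p) \<le> M)" for m
    unfolding M_def by (rule Np_approx_factor[OF p f r[of m] C]) (use r in auto)
  then obtain q where qpos: "\<And>m z. cmod z < 1 \<Longrightarrow> 0 \<le> Re (poly (q m) z)"
    and qf: "\<And>m z. cmod z < 1 \<Longrightarrow> cmod (f (of_real (r m) * z) * exp (- poly (q m) z)) \<le> 1"
    and qmean: "\<And>m s. 0 \<le> s \<Longrightarrow> s < 1 \<Longrightarrow> integral {0..2*pi} (\<lambda>t. Re (poly (q m) (of_real s * cis t)) powr p) \<le> M"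
    by metis
  define g where "g m z = exp (- poly (q m) z)" for m z
  have g_hol: "g m holomorphic_on S" for m S
    unfolding g_def by (intro holomorphic_intros)
  have g_le: "cmod (g m z) \<le> 1" if "cmod z < 1" for m z
    using qpos[OF that] by (simp add: g_def)
  obtain G s where G: "G holomorphic_on ball 0 1" and s: "strict_mono (s :: nat \<Rightarrow> nat)"
    and Glim: "\<And>z. z \<in> ball 0 1 \<Longrightarrow> (\<lambda>n. g (s n) z) \<longlonglongrightarrow> G z"
    and Gunif: "\<And>K. compact K \<Longrightarrow> K \<subseteq> ball 0 1 \<Longrightarrow> uniform_limit K (g \<circ> s) G sequentially"
  proof (rule Montel[of "ball 0 1" "{h. h holomorphic_on ball 0 1 \<and> (\<forall>z\<in>ball 0 1. cmod (h z) \<le> 1)}" g])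
    show "range g \<subseteq> {h. h holomorphic_on ball 0 1 \<and> (\<forall>z\<in>ball 0 1. cmod (h z) \<le> 1)}"
      using g_hol g_le by auto
  qed (auto intro!: exI[of _ 1])
  have G0: "G 0 \<noteq> 0"
  proof -
    define a where "a m = Re (poly (q m) 0)" for m
    define b where "b = (M / (2*pi)) powr (1/p)"
    have "a m \<le> b" for m
    proof -
      have "2 * pi * a m powr p \<le> M"
        using qmean[of 0 m] by (simp add: a_def)
      then have "a m powr p \<le> M / (2*pi)" by (simp add: field_simps)
      then have "(a m powr p) powr (1/p) \<le> b"
        unfolding b_def using p by (intro powr_mono2) auto
      then show ?thesis
        using p qpos[of 0 m] by (simp add: a_def powr_powr)
    qed
    then have "exp (- b) \<le> cmod (g (s n) 0)" for n
      by (simp add: g_def a_def)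
    then have "exp (- b) \<le> cmod (G 0)"
      by (intro LIMSEQ_le_const[OF tendsto_norm[OF Glim]]) auto
    then show ?thesis
      by (metis exp_gt_zero norm_zero not_le)
  qed
  have Gnz: "G z \<noteq> 0" if z: "cmod z < 1" for z
  proof (cases "G constant_on ball 0 1")
    case True
    then have "G z = G 0" using z by (auto simp: constant_on_def)
    then show ?thesis using G0 by simp
  next
    case False
    show ?thesis
    proof (rule Hurwitz_no_zeros[OF _ _ _ G Gunif False])
      show "(g \<circ> s) n holomorphic_on ball 0 1" for n by (simp add: g_hol)
    qed (use z in \<open>auto simp: g_def\<close>)
  qed
  have Gle: "cmod (G z) \<le> 1" if z: "cmod z < 1" for z
    using g_le[OF z] z by (intro LIMSEQ_le_const2[OF tendsto_norm[OF Glim]]) auto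
  have fG: "cmod (f z * G z) \<le> 1" if z: "cmod z < 1" for z
  proof (rule LIMSEQ_le_const2)
    have rs: "(\<lambda>n. r (s n)) \<longlonglongrightarrow> 1"
      using LIMSEQ_subseq_LIMSEQ[OF rlim s] by (simp add: o_def)
    have "isCont f z"
      using holomorphic_on_imp_continuous_on[OF f] z by (simp add: continuous_on_eq_continuous_at)
    moreover have "(\<lambda>n. of_real (r (s n)) * z) \<longlonglongrightarrow> z"
      using tendsto_mult[OF tendsto_of_real[OF rs] tendsto_const[of z]] by simp
    ultimately have "(\<lambda>n. f (of_real (r (s n)) * z)) \<longlonglongrightarrow> f z"
      by (rule isCont_tendsto_compose)
    then show "(\<lambda>n. cmod (f (of_real (r (s n)) * z) * g (s n) z)) \<longlonglongrightarrow> cmod (f z * G z)"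
      using z by (intro tendsto_intros Glim) auto
  qed (use qf[OF z] in \<open>auto simp: g_def\<close>)
  have inv: "(\<lambda>z\<in>ball 0 1. 1 / G z) \<in> Np p"
    unfolding Np_iff[OF p0]
  proof (intro conjI exI ballI)
    have "(\<lambda>z. 1 / G z) holomorphic_on ball 0 1"
      using Gnz by (intro holomorphic_intros G) auto
    then show hol: "(\<lambda>z\<in>ball 0 1. 1 / G z) holomorphic_on ball 0 1"
      by (rule holomorphic_transform) auto
    fix \<rho> :: real assume \<rho>: "\<rho> \<in> {0<..<1}"
    define z where "z t = of_real \<rho> * cis t" for t
    have z: "cmod (z t) < 1" for t using \<rho> by (simp add: z_def norm_mult)
    define F where "F n t = Re (poly (q (s n)) (z t)) powr p" for n t
    have Fcont: "continuous_on S (F n)" for n S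
      unfolding F_def z_def[abs_def] using qpos[OF z] 
      by (intro Re_powr_continuous p continuous_intros holomorphic_intros) (auto simp: z_def)
    have "(\<lambda>n. F n t) \<longlonglongrightarrow> log_plus (cmod (1 / G (z t))) powr p" for t
    proof -
      have "(\<lambda>n. - ln (cmod (g (s n) (z t)))) \<longlonglongrightarrow> - ln (cmod (G (z t)))"
        using z[of t] Gnz[OF z] by (intro tendsto_intros Glim) auto
      moreover have "- ln (cmod (g n w)) = Re (poly (q n) w)" for n w by (simp add: g_def)
      moreover have "- ln (cmod (G (z t))) = log_plus (cmod (1 / G (z t)))"
        using Gnz[OF z, of t] Gle[OF z, of t]
        by (simp add: log_plus_def norm_divide ln_div max_def)
      ultimately have "(\<lambda>n. Re (poly (q (s n)) (z t))) \<longlonglongrightarrow> log_plus (cmod (1 / G (z t)))" by simp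
      then show ?thesis
        unfolding F_def using p qpos[OF z] by (intro tendsto_powr2 tendsto_intros) auto
    qed
    then have lim: "(\<lambda>n. ennreal (F n t) * indicator {0..2*pi} t) \<longlonglongrightarrow>
        ennreal (log_plus (cmod (1 / G (z t))) powr p) * indicator {0..2*pi} t" for t
      by (auto simp: indicator_def intro: tendsto_ennrealI)
    have "ennreal (log_mean p (\<lambda>z\<in>ball 0 1. 1 / G z) \<rho>)
        = (\<integral>\<^sup>+t\<in>{0..2*pi}. ennreal (log_plus (cmod ((\<lambda>z\<in>ball 0 1. 1 / G z) (of_real \<rho> * cis t))) powr p) \<partial>lborel)"
      unfolding log_mean_def using \<rho> p
      by (intro circle_nn_integral[symmetric] log_plus_powr_continuous circle_continuous hol) auto
    also have "\<dots> = (\<integral>\<^sup>+t\<in>{0..2*pi}. ennreal (log_plus (cmod (1 / G (z t))) powr p) \<partial>lborel)"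
      using z by (intro nn_integral_cong) (auto simp: z_def)
    also have "\<dots> = (\<integral>\<^sup>+t. liminf (\<lambda>n. ennreal (F n t) * indicator {0..2*pi} t) \<partial>lborel)"
      by (intro nn_integral_cong lim_imp_Liminf[symmetric] lim) auto
    also have "\<dots> \<le> liminf (\<lambda>n. \<integral>\<^sup>+t. ennreal (F n t) * indicator {0..2*pi} t \<partial>lborel)"
    proof (rule nn_integral_liminf)
      have "F n \<in> borel_measurable borel" for n
        by (rule borel_measurable_continuous_onI[OF Fcont])
      then show "(\<lambda>t. ennreal (F n t) * indicator {0..2*pi} t) \<in> borel_measurable lborel" for n
        by measurable
    qed
    also have "\<dots> = liminf (\<lambda>n. ennreal (integral {0..2*pi} (F n)))"
      by (subst circle_nn_integral[OF Fcont]) (auto simp: F_def)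
    also have "\<dots> \<le> ennreal M"
    proof (rule Liminf_le)
      show "\<forall>\<^sub>F n in sequentially. ennreal (integral {0..2*pi} (F n)) \<le> ennreal M"
        unfolding F_def z_def using qmean \<rho> by (intro always_eventually allI ennreal_leI) auto
    qed auto
    finally have "ennreal (log_mean p (\<lambda>z\<in>ball 0 1. 1 / G z) \<rho>) \<le> ennreal M" .
    moreover have "0 \<le> M"
      using qmean[of 0 0] by (rule order_trans[rotated]) (auto intro!: integral_nonneg)
    ultimately show "log_mean p (\<lambda>z\<in>ball 0 1. 1 / G z) \<rho> \<le> M"
      by (simp add: ennreal_le_iff)
  qed auto
  show thesis by (rule that[OF G Gnz Gle fG inv])
qed

text \<open>The product of the factors for the individual functions works, because each of them is bounded by 1.\<close>

lemma Np_common_factor: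
  assumes p: "1 \<le> p" and I: "finite I" and a: "\<And>i. i \<in> I \<Longrightarrow> a i \<in> Np p"
  obtains G where "G holomorphic_on ball 0 1" "\<And>z. cmod z < 1 \<Longrightarrow> G z \<noteq> 0"
    "\<And>i z. i \<in> I \<Longrightarrow> cmod z < 1 \<Longrightarrow> cmod (a i z * G z) \<le> 1"
    "(\<lambda>z\<in>ball 0 1. 1 / G z) \<in> Np p"
proof -
  have p0: "0 < p" using p by simp
  define P where "P i G \<longleftrightarrow> G holomorphic_on ball 0 1 \<and> (\<forall>z. cmod z < 1 \<longrightarrow> G z \<noteq> 0) \<and>
    (\<forall>z. cmod z < 1 \<longrightarrow> cmod (G z) \<le> 1) \<and> (\<forall>z. cmod z < 1 \<longrightarrow> cmod (a i z * G z) \<le> 1) \<and>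
    (\<lambda>z\<in>ball 0 1. 1 / G z) \<in> Np p" for i and G :: "complex \<Rightarrow> complex"
  have "\<exists>G. P i G" if "i \<in> I" for i
    unfolding P_def by (rule Np_factor[OF p a[OF that]]) blast
  then have "\<forall>i\<in>I. \<exists>G. P i G" by blast
  from bchoice[OF this] obtain G where "\<forall>i\<in>I. P i (G i)" by blast
  then have G: "\<And>i. i \<in> I \<Longrightarrow> G i holomorphic_on ball 0 1"
    "\<And>i z. i \<in> I \<Longrightarrow> cmod z < 1 \<Longrightarrow> G i z \<noteq> 0"
    "\<And>i z. i \<in> I \<Longrightarrow> cmod z < 1 \<Longrightarrow> cmod (G i z) \<le> 1"
    "\<And>i z. i \<in> I \<Longrightarrow> cmod z < 1 \<Longrightarrow> cmod (a i z * G i z) \<le> 1"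
    "\<And>i. i \<in> I \<Longrightarrow> (\<lambda>z\<in>ball 0 1. 1 / G i z) \<in> Np p"
    by (auto simp: P_def)
  show thesis
  proof (rule that[of "\<lambda>z. \<Prod>i\<in>I. G i z"])
    show "(\<lambda>z. \<Prod>i\<in>I. G i z) holomorphic_on ball 0 1"
      by (intro holomorphic_intros G)
    show "(\<Prod>i\<in>I. G i z) \<noteq> 0" if "cmod z < 1" for z
      using G(2) that I by simp
    show "cmod (a i z * (\<Prod>i\<in>I. G i z)) \<le> 1" if i: "i \<in> I" and z: "cmod z < 1" for i z
    proof -
      have "a i z * (\<Prod>i\<in>I. G i z) = (a i z * G i z) * (\<Prod>i\<in>I - {i}. G i z)"
        using prod.remove[OF I i, of "\<lambda>i. G i z"] by simp
      then have "cmod (a i z * (\<Prod>i\<in>I. G i z)) = cmod (a i z * G i z) * cmod (\<Prod>i\<in>I - {i}. G i z)"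
        by (metis norm_mult)
      also have "\<dots> \<le> 1 * 1"
      proof (rule mult_mono[OF G(4)[OF i z]])
        show "cmod (\<Prod>i\<in>I - {i}. G i z) \<le> 1"
          unfolding prod_norm[symmetric] using G(3) z by (intro prod_le_1) auto
      qed auto
      finally show ?thesis by simp
    qed
    have "(\<lambda>z\<in>ball 0 1. \<Prod>i\<in>I. (\<lambda>z\<in>ball 0 1. 1 / G i z) z) \<in> Np p"
      by (intro Np_prod p0 G)
    also have "(\<lambda>z\<in>ball 0 1. \<Prod>i\<in>I. (\<lambda>z\<in>ball 0 1. 1 / G i z) z) = (\<lambda>z\<in>ball 0 1. 1 / (\<Prod>i\<in>I. G i z))"
      by (auto simp: fun_eq_iff prod_dividef)
    finally show "(\<lambda>z\<in>ball 0 1. 1 / (\<Prod>i\<in>I. G i z)) \<in> Np p" .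
  qed
qed

section \<open>Parseval and the Hardy space\<close>

lemma integral_cis_multiple:
  "((\<lambda>t. cis (of_int n * t)) has_integral (if n = 0 then 2 * of_real pi else 0)) {0..2*pi}"
proof (cases "n = 0")
  case True
  then show ?thesis using has_integral_const_real[of "1::complex" 0 "2*pi"] by (simp add: scaleR_conv_of_real)
next
  case False
  define F where "F t = cis (of_int n * t) / (\<i> * of_int n)" for t
  have "((\<lambda>t. cis (of_int n * t)) has_integral F (2*pi) - F 0) {0..2*pi}"
  proof (rule fundamental_theorem_of_calculus)
    fix t :: real
    show "(F has_vector_derivative cis (of_int n * t)) (at t within {0..2*pi})"
    proof -
      have "((\<lambda>z. exp (\<i> * of_int n * z) / (\<i> * of_int n)) has_field_derivative
          exp (\<i> * of_int n * of_real t)) (at (of_real t))"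
        using False by (auto intro!: derivative_eq_intros)
      from has_vector_derivative_real_field[OF this]
      show ?thesis unfolding F_def[abs_def] cis_conv_exp by (simp add: mult.assoc)
    qed
  qed auto
  moreover have "cis (of_int n * (2*pi)) = 1"
    by (metis cis_multiple_2pi Ints_of_int mult.commute)
  ultimately show ?thesis using False by (simp add: F_def)
qed

lemma parseval_polynomial:
  "((\<lambda>t. (cmod (\<Sum>k<K. a k * cis (real k * t)))\<^sup>2) has_integral 2 * pi * (\<Sum>k<K. (cmod (a k))\<^sup>2)) {0..2*pi}"
proof -
  have "((\<lambda>t. \<Sum>j<K. \<Sum>k<K. a j * cnj (a k) * cis (of_int (int j - int k) * t)) has_integral
      (\<Sum>j<K. \<Sum>k<K. a j * cnj (a k) * (if int j - int k = 0 then 2 * of_real pi else 0))) {0..2*pi}"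
    by (intro has_integral_sum has_integral_mult_right integral_cis_multiple) auto
  moreover have "(\<Sum>j<K. \<Sum>k<K. a j * cnj (a k) * (if int j - int k = 0 then 2 * of_real pi else 0))
      = of_real (2 * pi * (\<Sum>k<K. (cmod (a k))\<^sup>2))"
  proof -
    have "(\<Sum>k<K. a j * cnj (a k) * (if int j - int k = 0 then 2 * of_real pi else 0))
        = of_real (2 * pi * (cmod (a j))\<^sup>2)" if "j < K" for j
    proof -
      have "(\<Sum>k<K. a j * cnj (a k) * (if int j - int k = 0 then 2 * of_real pi else 0))
          = (\<Sum>k<K. if k = j then a j * cnj (a j) * (2 * of_real pi) else 0)"
        by (intro sum.cong) auto
      also have "\<dots> = a j * cnj (a j) * (2 * of_real pi)" using that by simp
      finally show ?thesis
        unfolding of_real_mult complex_norm_square by (simp add: mult.commute)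
    qed
    then show ?thesis
      by (simp add: sum_distrib_left)
  qed
  moreover have "(\<Sum>j<K. \<Sum>k<K. a j * cnj (a k) * cis (of_int (int j - int k) * t))
      = of_real ((cmod (\<Sum>k<K. a k * cis (real k * t)))\<^sup>2)" for t
  proof -
    have "of_real ((cmod (\<Sum>k<K. a k * cis (real k * t)))\<^sup>2)
        = (\<Sum>j<K. a j * cis (real j * t)) * (\<Sum>k<K. cnj (a k * cis (real k * t)))"
      unfolding complex_norm_square by simp
    also have "\<dots> = (\<Sum>j<K. \<Sum>k<K. (a j * cis (real j * t)) * cnj (a k * cis (real k * t)))"
      by (rule sum_product)
    also have "\<dots> = (\<Sum>j<K. \<Sum>k<K. a j * cnj (a k) * cis (of_int (int j - int k) * t))"
    proof (intro sum.cong refl)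
      fix j k
      have "cis (of_int (int j - int k) * t) = cis (real j * t) * cis (- (real k * t))"
        by (simp add: cis_mult algebra_simps)
      then show "(a j * cis (real j * t)) * cnj (a k * cis (real k * t)) = a j * cnj (a k) * cis (of_int (int j - int k) * t)"
        by (simp add: cis_cnj)
    qed
    finally show ?thesis by simp
  qed
  ultimately have "((\<lambda>t. of_real ((cmod (\<Sum>k<K. a k * cis (real k * t)))\<^sup>2) :: complex) has_integral
      of_real (2 * pi * (\<Sum>k<K. (cmod (a k))\<^sup>2))) {0..2*pi}"
    by simp
  from has_integral_Re[OF this] show ?thesis by simp
qed

lemma parseval:
  assumes s: "summable (\<lambda>k. cmod (a k))"
  shows "((\<lambda>t. (cmod (\<Sum>k. a k * cis (real k * t)))\<^sup>2) has_integral 2 * pi * (\<Sum>k. (cmod (a k))\<^sup>2)) {0..2*pi}"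
    and "summable (\<lambda>k. (cmod (a k))\<^sup>2)"
proof -
  let ?A = "\<Sum>k. cmod (a k)"
  have s': "summable (\<lambda>k. a k * cis (real k * t))" for t
    by (rule summable_norm_cancel) (use s in \<open>simp add: norm_mult\<close>)
  show sum_sq: "summable (\<lambda>k. (cmod (a k))\<^sup>2)"
  proof (rule summable_comparison_test'[OF summable_mult[OF s, of ?A]])
    fix k
    have "cmod (a k) \<le> ?A" using sum_le_suminf[OF s, of "{k}"] by simp
    then show "norm ((cmod (a k))\<^sup>2) \<le> ?A * cmod (a k)"
      by (simp add: power2_eq_square mult_right_mono)
  qed
  show "((\<lambda>t. (cmod (\<Sum>k. a k * cis (real k * t)))\<^sup>2) has_integral 2 * pi * (\<Sum>k. (cmod (a k))\<^sup>2)) {0..2*pi}"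
  proof (rule has_integral_dominated_convergence[OF parseval_polynomial, where h="\<lambda>_. ?A\<^sup>2"])
    show "\<forall>t\<in>{0..2*pi}. norm ((cmod (\<Sum>k<K. a k * cis (real k * t)))\<^sup>2) \<le> ?A\<^sup>2" for K
    proof
      fix t
      have "cmod (\<Sum>k<K. a k * cis (real k * t)) \<le> (\<Sum>k<K. cmod (a k))"
        by (rule order_trans[OF norm_sum]) (simp add: norm_mult)
      also have "\<dots> \<le> ?A" by (intro sum_le_suminf s) auto
      finally show "norm ((cmod (\<Sum>k<K. a k * cis (real k * t)))\<^sup>2) \<le> ?A\<^sup>2"
        by (simp add: power_mono)
    qed
    show "\<forall>t\<in>{0..2*pi}. (\<lambda>K. (cmod (\<Sum>k<K. a k * cis (real k * t)))\<^sup>2) \<longlonglongrightarrow> (cmod (\<Sum>k. a k * cis (real k * t)))\<^sup>2"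
      using s' by (intro ballI tendsto_intros summable_LIMSEQ)
    show "(\<lambda>K. 2 * pi * (\<Sum>k<K. (cmod (a k))\<^sup>2)) \<longlonglongrightarrow> 2 * pi * (\<Sum>k. (cmod (a k))\<^sup>2)"
      using sum_sq by (intro tendsto_intros summable_LIMSEQ)
  qed auto
qed

lemma log_plus_powr_le:
  assumes p: "0 < p" and x: "0 \<le> x"
  shows "log_plus x powr p \<le> (p / 2) powr p * x\<^sup>2"
proof (cases "1 \<le> x")
  case True
  have "ln (x powr (2 / p)) \<le> x powr (2 / p)"
    using True ln_bound[of "x powr (2 / p)"] by auto
  then have "ln x \<le> p / 2 * x powr (2 / p)"
    using True p by (simp add: ln_powr field_simps)
  then have "ln x powr p \<le> (p / 2 * x powr (2 / p)) powr p"
    using True p by (intro powr_mono2) auto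
  also have "\<dots> = (p / 2) powr p * (x powr (2 / p)) powr p"
    by (rule powr_mult)
  also have "(x powr (2 / p)) powr p = x\<^sup>2"
    using True p by (simp add: powr_powr)
  finally show ?thesis using True by (simp add: log_plus_eq max_def)
next
  case False
  then show ?thesis using x by (simp add: log_plus_eq max_def)
qed

text \<open>Parseval bounds the means of \<open>\<bar>f\<bar>\<^sup>2\<close>, which dominate those of \<open>(log\<^sup>+ \<bar>f\<bar>)\<^sup>p\<close> up to a constant.\<close>

theorem hardy_in_Np:
  assumes p: "0 < p" and x: "square_summable x"
  shows "(\<lambda>z\<in>ball 0 1. pseries x z) \<in> Np p"
  unfolding Np_iff[OF p]
proof (intro conjI exI ballI)
  show hol: "(\<lambda>z\<in>ball 0 1. pseries x z) holomorphic_on ball 0 1"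
    by (rule holomorphic_transform[OF pseries_holomorphic[OF x]]) auto
  fix r :: real assume r: "r \<in> {0<..<1}"
  define a where "a k = x k * of_real r ^ k" for k
  have rz: "cmod (of_real r * cis t) < 1" for t using r by (simp add: norm_mult)
  have s: "summable (\<lambda>k. cmod (a k))"
    unfolding a_def using r by (intro pseries_summable[OF square_summable_coeff_bound[OF x]]) auto
  have pseries: "pseries x (of_real r * cis t) = (\<Sum>k. a k * cis (real k * t))" for t
    unfolding pseries_def a_def by (simp add: power_mult_distrib Complex.DeMoivre mult.assoc)
  have "(\<Sum>k. (cmod (a k))\<^sup>2) \<le> sum_sq x"
    unfolding sum_sq_def
  proof (rule suminf_le)
    show "(cmod (a k))\<^sup>2 \<le> (cmod (x k))\<^sup>2" for k
    proof (rule power_mono)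
      have "cmod (x k) * r ^ k \<le> cmod (x k)" 
        using r by (intro mult_right_le_one_le) (auto simp: power_le_one)
      then show "cmod (a k) \<le> cmod (x k)" using r by (simp add: a_def norm_mult norm_power)
    qed auto
  qed (use x parseval(2)[OF s] in \<open>auto simp: square_summable_def\<close>)
  moreover have "log_mean p (\<lambda>z\<in>ball 0 1. pseries x z) r \<le> (p / 2) powr p * (2 * pi * (\<Sum>k. (cmod (a k))\<^sup>2))"
    unfolding log_mean_def
  proof (rule has_integral_le[OF integrable_integral[OF log_mean_integrable[OF hol r p]]])
    show "((\<lambda>t. (p / 2) powr p * (cmod (pseries x (of_real r * cis t)))\<^sup>2) has_integral
        (p / 2) powr p * (2 * pi * (\<Sum>k. (cmod (a k))\<^sup>2))) {0..2*pi}"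
      unfolding pseries by (intro has_integral_mult_right parseval(1)[OF s])
    show "log_plus (cmod ((\<lambda>z\<in>ball 0 1. pseries x z) (of_real r * cis t))) powr p
        \<le> (p / 2) powr p * (cmod (pseries x (of_real r * cis t)))\<^sup>2" for t
      using log_plus_powr_le[OF p] rz[of t] by simp
  qed
  ultimately show "log_mean p (\<lambda>z\<in>ball 0 1. pseries x z) r \<le> (p / 2) powr p * (2 * pi * sum_sq x)"
    by (meson mult_left_mono order_trans powr_ge_zero pi_ge_zero mult_nonneg_nonneg zero_le_numeral)
qed auto

text \<open>
  Parseval on the circle of radius \<open>r\<close> bounds the sum of the squares weighted by \<open>r ^ (2 * k)\<close>; then let
  \<open>r\<close> tend to 1 in each partial sum.
\<close>

theorem bounded_in_hardy:
  assumes f: "f holomorphic_on ball 0 1" and B: "\<And>z. cmod z < 1 \<Longrightarrow> cmod (f z) \<le> B"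
  obtains x where "square_summable x" "\<And>z. cmod z < 1 \<Longrightarrow> f z = pseries x z"
proof -
  define x where "x k = (deriv ^^ k) f 0 / fact k" for k
  have sums: "(\<lambda>k. x k * z ^ k) sums f z" if "cmod z < 1" for z
    using holomorphic_power_series[OF f, of z] that by (simp add: x_def)
  have partial: "(\<Sum>k<K. (cmod (x k * of_real r ^ k))\<^sup>2) \<le> B\<^sup>2" if r: "0 < r" "r < 1" for r :: real and K
  proof -
    define a where "a k = x k * of_real r ^ k" for k
    \<comment> \<open>Convergence at a larger radius gives absolute convergence at \<open>r\<close>.\<close>
    define R where "R = (1 + r) / 2"
    have R: "r < R" "R < 1" using r by (auto simp: R_def)
    have s: "summable (\<lambda>k. cmod (a k))"
      unfolding a_def
      by (rule powser_insidea[OF sums_summable[OF sums[of "of_real R"]]]) (use R r in auto)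
    have rz: "cmod (of_real r * cis t) < 1" for t using r by (simp add: norm_mult)
    have "(\<Sum>k. a k * cis (real k * t)) = f (of_real r * cis t)" for t
      using sums[OF rz[of t]] by (simp add: sums_iff a_def power_mult_distrib Complex.DeMoivre mult.assoc)
    then have "cmod (\<Sum>k. a k * cis (real k * t)) \<le> B" for t
      using B[OF rz] by simp
    then have "(cmod (\<Sum>k. a k * cis (real k * t)))\<^sup>2 \<le> B\<^sup>2" for t
      by (intro power_mono) auto
    moreover have "((\<lambda>t. B\<^sup>2) has_integral 2 * pi * B\<^sup>2) {0..2*pi}"
      using has_integral_const_real[of "B\<^sup>2" 0 "2*pi"] by simp
    ultimately have "2 * pi * (\<Sum>k. (cmod (a k))\<^sup>2) \<le> 2 * pi * B\<^sup>2"
      using has_integral_le[OF parseval(1)[OF s]] by blast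
    then have "(\<Sum>k. (cmod (a k))\<^sup>2) \<le> B\<^sup>2" by simp
    moreover have "(\<Sum>k<K. (cmod (a k))\<^sup>2) \<le> (\<Sum>k. (cmod (a k))\<^sup>2)"
      by (intro sum_le_suminf parseval(2)[OF s]) auto
    ultimately show ?thesis by (simp add: a_def)
  qed
  have "(\<Sum>k<K. (cmod (x k))\<^sup>2) \<le> B\<^sup>2" for K
  proof (rule tendsto_upperbound)
    have "((\<lambda>r. \<Sum>k<K. (cmod (x k * of_real r ^ k))\<^sup>2) \<longlongrightarrow> (\<Sum>k<K. (cmod (x k * of_real 1 ^ k))\<^sup>2)) (at_left 1)"
      by (intro tendsto_intros)
    then show "((\<lambda>r. \<Sum>k<K. (cmod (x k * of_real r ^ k))\<^sup>2) \<longlongrightarrow> (\<Sum>k<K. (cmod (x k))\<^sup>2)) (at_left 1)"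
      by simp
    have "\<forall>\<^sub>F r in at_left (1::real). r \<in> {0<..<1}"
      by (rule eventually_at_left_real) auto
    then show "\<forall>\<^sub>F r in at_left 1. (\<Sum>k<K. (cmod (x k * of_real r ^ k))\<^sup>2) \<le> B\<^sup>2"
      by eventually_elim (auto intro: partial)
  qed auto
  then have "square_summable x" by (rule square_summable_bounded_partial(1))
  moreover have "f z = pseries x z" if "cmod z < 1" for z
    using sums[OF that] by (simp add: pseries_def sums_iff)
  ultimately show thesis by (rule that)
qed

section \<open>Syzygies over N^p\<close>

text \<open>
  The \<open>E j\<close>, with entries in \<open>N\<^sup>p\<close>, generate the module of syzygies over \<open>N\<^sup>p\<close> of the family \<open>f\<close>; identities
  are required on the disk only.
\<close>

definition syzygy_generators ::
  "real \<Rightarrow> 'i set \<Rightarrow> ('i \<Rightarrow> complex \<Rightarrow> complex) \<Rightarrow> 'j set \<Rightarrow> ('j \<Rightarrow> 'i \<Rightarrow> complex \<Rightarrow> complex) \<Rightarrow> bool"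
  where "syzygy_generators p I f J E \<longleftrightarrow>
    (\<forall>j\<in>J. \<forall>i\<in>I. E j i \<in> Np p) \<and>
    (\<forall>j\<in>J. \<forall>z. cmod z < 1 \<longrightarrow> (\<Sum>i\<in>I. E j i z * f i z) = 0) \<and>
    (\<forall>a. (\<forall>i\<in>I. a i \<in> Np p) \<and> (\<forall>z. cmod z < 1 \<longrightarrow> (\<Sum>i\<in>I. a i z * f i z) = 0) \<longrightarrow>
      (\<exists>h. (\<forall>j\<in>J. h j \<in> Np p) \<and> (\<forall>i\<in>I. \<forall>z. cmod z < 1 \<longrightarrow> a i z = (\<Sum>j\<in>J. h j z * E j i z))))"

text \<open>
  The generators come from the square-summable theory. An arbitrary syzygy is first multiplied by a
  common factor \<open>G\<close> that makes it bounded, hence square summable, and \<open>1 / G\<close> is then absorbed into the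
  multipliers.
\<close>

theorem Np_syzygies_finitely_generated:
  fixes f :: "'i \<Rightarrow> complex \<Rightarrow> complex"
  assumes p: "1 \<le> p" and I: "finite I" and f: "\<forall>i\<in>I. f i holomorphic_on ball 0 1"
  shows "\<exists>(J :: 'i set) E. finite J \<and> syzygy_generators p I f J E"
proof -
  have p0: "0 < p" using p by simp
  interpret syzygies I f
    by standard (use I f holomorphic_on_imp_continuous_on in auto)
  obtain J e where J: "J \<subseteq> I" and e: "\<And>j. j \<in> J \<Longrightarrow> e j \<in> syz"
    and gen: "\<And>c. c \<in> syz \<Longrightarrow> \<exists>h. (\<forall>j\<in>J. square_summable (h j)) \<and>
      (\<forall>i\<in>I. \<forall>z. cmod z < 1 \<longrightarrow> pseries (c i) z = (\<Sum>j\<in>J. pseries (h j) z * pseries (e j i) z))"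
    by (rule syz_finitely_generated) blast
  show ?thesis
    unfolding syzygy_generators_def
  proof (intro exI[of _ J] exI[of _ "\<lambda>j i. \<lambda>z\<in>ball 0 1. pseries (e j i) z"] conjI ballI allI impI)
    show "finite J" using J I by (rule finite_subset)
    show "(\<lambda>z\<in>ball 0 1. pseries (e j i) z) \<in> Np p" if "j \<in> J" "i \<in> I" for j i
      by (rule hardy_in_Np[OF p0 syz_square_summable[OF e[OF that(1)] that(2)]])
    show "(\<Sum>i\<in>I. (\<lambda>z\<in>ball 0 1. pseries (e j i) z) z * f i z) = 0" if "j \<in> J" "cmod z < 1" for j z
      using e[OF that(1)] that(2) by (simp add: syz_def)
    fix a assume "(\<forall>i\<in>I. a i \<in> Np p) \<and> (\<forall>z. cmod z < 1 \<longrightarrow> (\<Sum>i\<in>I. a i z * f i z) = 0)"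
    then have a: "\<And>i. i \<in> I \<Longrightarrow> a i \<in> Np p"
      and az: "\<And>z. cmod z < 1 \<Longrightarrow> (\<Sum>i\<in>I. a i z * f i z) = 0" by blast+
    obtain G where G: "G holomorphic_on ball 0 1" "\<And>z. cmod z < 1 \<Longrightarrow> G z \<noteq> 0"
      "\<And>i z. i \<in> I \<Longrightarrow> cmod z < 1 \<Longrightarrow> cmod (a i z * G z) \<le> 1"
      "(\<lambda>z\<in>ball 0 1. 1 / G z) \<in> Np p"
      by (rule Np_common_factor[OF p I a]) blast+
    have "\<exists>x. square_summable x \<and> (\<forall>z. cmod z < 1 \<longrightarrow> a i z * G z = pseries x z)" if i: "i \<in> I" for i
    proof -
      have "(\<lambda>z. a i z * G z) holomorphic_on ball 0 1"
        using a[OF i] by (intro holomorphic_intros G) (auto simp: Np_iff[OF p0])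
      then show ?thesis
        by (rule bounded_in_hardy[OF _ G(3)[OF i]]) blast+
    qed
    then obtain c where c: "\<And>i. i \<in> I \<Longrightarrow> square_summable (c i)"
      "\<And>i z. i \<in> I \<Longrightarrow> cmod z < 1 \<Longrightarrow> a i z * G z = pseries (c i) z" by metis
    have "c \<in> syz"
      unfolding syz_def
    proof (intro CollectI conjI ballI allI impI)
      fix z :: complex assume z: "cmod z < 1"
      have "(\<Sum>i\<in>I. pseries (c i) z * f i z) = (\<Sum>i\<in>I. G z * (a i z * f i z))"
        by (intro sum.cong) (auto simp: c(2)[OF _ z, symmetric])
      then show "(\<Sum>i\<in>I. pseries (c i) z * f i z) = 0"
        using az[OF z] by (simp flip: sum_distrib_left)
    qed (rule c)
    from gen[OF this] obtain h where h: "\<And>j. j \<in> J \<Longrightarrow> square_summable (h j)"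
      "\<And>i z. i \<in> I \<Longrightarrow> cmod z < 1 \<Longrightarrow> pseries (c i) z = (\<Sum>j\<in>J. pseries (h j) z * pseries (e j i) z)"
      by blast
    define k where "k j = (\<lambda>z\<in>ball 0 1. (\<lambda>z\<in>ball 0 1. pseries (h j) z) z * (\<lambda>z\<in>ball 0 1. 1 / G z) z)" for j
    have "k j \<in> Np p" if "j \<in> J" for j
      unfolding k_def by (intro Np_mult p0 hardy_in_Np h that G)
    moreover have "a i z = (\<Sum>j\<in>J. k j z * (\<lambda>z\<in>ball 0 1. pseries (e j i) z) z)" if i: "i \<in> I" and z: "cmod z < 1" for i z
    proof -
      have "a i z = pseries (c i) z / G z"
        using c(2)[OF i z] G(2)[OF z] by (simp add: field_simps)
      then show ?thesis
        unfolding h(2)[OF i z] using z by (simp add: k_def sum_divide_distrib)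
    qed
    ultimately show "\<exists>h. (\<forall>j\<in>J. h j \<in> Np p) \<and>
        (\<forall>i\<in>I. \<forall>z. cmod z < 1 \<longrightarrow> a i z = (\<Sum>j\<in>J. h j z * (\<lambda>z\<in>ball 0 1. pseries (e j i) z) z))"
      by blast
  qed
qed

section \<open>Ideals of N^p\<close>

lemma Np_extensional: "f \<in> Np p \<Longrightarrow> f \<in> extensional (ball 0 1)"
  by (simp add: Np_def)

lemma Np_eqI: "f \<in> Np p \<Longrightarrow> g \<in> Np p \<Longrightarrow> (\<And>z. cmod z < 1 \<Longrightarrow> f z = g z) \<Longrightarrow> f = g"
  by (rule extensionalityI[OF Np_extensional Np_extensional]) auto

lemma Np_ring_simps:
  "carrier (Np_ring p) = Np p"
  "f \<otimes>\<^bsub>Np_ring p\<^esub> g = (\<lambda>z\<in>ball 0 1. f z * g z)"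
  "f \<oplus>\<^bsub>Np_ring p\<^esub> g = (\<lambda>z\<in>ball 0 1. f z + g z)"
  "\<one>\<^bsub>Np_ring p\<^esub> = (\<lambda>z\<in>ball 0 1. 1)"
  "\<zero>\<^bsub>Np_ring p\<^esub> = (\<lambda>z\<in>ball 0 1. 0)"
  by (simp_all add: Np_ring_def)

lemma cring_Np:
  assumes p: "0 < p"
  shows "cring (Np_ring p)"
proof (rule cringI)
  show "abelian_group (Np_ring p)"
  proof (rule abelian_groupI)
    fix f assume f: "f \<in> carrier (Np_ring p)"
    then have "(\<lambda>z\<in>ball 0 1. (\<lambda>z\<in>ball 0 1. -1) z * f z) \<in> Np p"
      by (intro Np_mult Np_const p) (simp add: Np_ring_simps)
    then show "\<exists>g\<in>carrier (Np_ring p). g \<oplus>\<^bsub>Np_ring p\<^esub> f = \<zero>\<^bsub>Np_ring p\<^esub>"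
      by (intro bexI[of _ "\<lambda>z\<in>ball 0 1. (\<lambda>z\<in>ball 0 1. -1) z * f z"]) (auto simp: Np_ring_simps fun_eq_iff)
    show "\<zero>\<^bsub>Np_ring p\<^esub> \<oplus>\<^bsub>Np_ring p\<^esub> f = f"
      using Np_extensional f by (force simp: Np_ring_simps extensional_def fun_eq_iff)
  qed (auto simp: Np_ring_simps fun_eq_iff intro: Np_add Np_const p)
  show "comm_monoid (Np_ring p)"
  proof (rule comm_monoidI)
    fix f assume f: "f \<in> carrier (Np_ring p)"
    show "\<one>\<^bsub>Np_ring p\<^esub> \<otimes>\<^bsub>Np_ring p\<^esub> f = f"
      using Np_extensional f by (force simp: Np_ring_simps extensional_def fun_eq_iff)
  qed (auto simp: Np_ring_simps fun_eq_iff intro: Np_mult Np_const p)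
qed (auto simp: Np_ring_simps fun_eq_iff algebra_simps)

lemma ideal_linear_combination:
  assumes L: "ideal L (Np_ring p)" and K: "finite K"
    and h: "\<And>k. k \<in> K \<Longrightarrow> h k \<in> Np p" and g: "\<And>k. k \<in> K \<Longrightarrow> g k \<in> L"
  shows "(\<lambda>z\<in>ball 0 1. \<Sum>k\<in>K. h k z * g k z) \<in> L"
proof -
  interpret L: ideal L "Np_ring p" by (rule L)
  show ?thesis
    using K h g
  proof (induction K rule: finite_induct)
    case empty
    show ?case using additive_subgroup.zero_closed[OF ideal.axioms(1)[OF L]] by (simp only: Np_ring_simps sum.empty)
  next
    case (insert k K)
    have "h k \<otimes>\<^bsub>Np_ring p\<^esub> g k \<in> L"
      using insert.prems by (intro L.I_l_closed) (auto simp: Np_ring_simps)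
    moreover have "(\<lambda>z\<in>ball 0 1. \<Sum>k\<in>K. h k z * g k z) \<in> L"
      by (rule insert.IH) (use insert.prems in auto)
    ultimately have "(h k \<otimes>\<^bsub>Np_ring p\<^esub> g k) \<oplus>\<^bsub>Np_ring p\<^esub> (\<lambda>z\<in>ball 0 1. \<Sum>k\<in>K. h k z * g k z) \<in> L"
      by (rule additive_subgroup.a_closed[OF ideal.axioms(1)[OF L]])
    also have "(h k \<otimes>\<^bsub>Np_ring p\<^esub> g k) \<oplus>\<^bsub>Np_ring p\<^esub> (\<lambda>z\<in>ball 0 1. \<Sum>k\<in>K. h k z * g k z)
        = (\<lambda>z\<in>ball 0 1. \<Sum>k\<in>insert k K. h k z * g k z)"
      using insert.hyps by (auto simp: Np_ring_simps fun_eq_iff)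
    finally show ?case .
  qed
qed

text \<open>
  The usual description of a finitely generated ideal of a commutative ring, with the linear
  combinations written as functions on the disk so that they can be compared with syzygies.
\<close>

lemma genideal_Np:
  assumes p: "0 < p" and A: "finite A" "A \<subseteq> Np p"
  shows "genideal (Np_ring p) A = {(\<lambda>z\<in>ball 0 1. \<Sum>a\<in>A. c a z * a z) | c. \<forall>a\<in>A. c a \<in> Np p}"
    (is "_ = ?L")
proof
  interpret cring "Np_ring p" by (rule cring_Np[OF p])
  have L_carrier: "?L \<subseteq> Np p"
  proof clarify
    fix c assume "\<forall>a\<in>A. c a \<in> Np p"
    then have "(\<lambda>z\<in>ball 0 1. \<Sum>a\<in>A. (\<lambda>z\<in>ball 0 1. c a z * a z) z) \<in> Np p"
      using A by (intro Np_sum Np_mult p) auto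
    also have "(\<lambda>z\<in>ball 0 1. \<Sum>a\<in>A. (\<lambda>z\<in>ball 0 1. c a z * a z) z) = (\<lambda>z\<in>ball 0 1. \<Sum>a\<in>A. c a z * a z)"
      by (auto simp: fun_eq_iff)
    finally show "(\<lambda>z\<in>ball 0 1. \<Sum>a\<in>A. c a z * a z) \<in> Np p" .
  qed
  have L_mult: "g \<otimes>\<^bsub>Np_ring p\<^esub> x \<in> ?L" if x: "x \<in> ?L" and g: "g \<in> Np p" for g x
  proof -
    obtain c where c: "\<forall>a\<in>A. c a \<in> Np p" "x = (\<lambda>z\<in>ball 0 1. \<Sum>a\<in>A. c a z * a z)" using x by blast
    then show ?thesis
      using g by (intro CollectI exI[of _ "\<lambda>a. \<lambda>z\<in>ball 0 1. g z * c a z"])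
        (auto simp: Np_ring_simps fun_eq_iff sum_distrib_left mult.assoc intro: Np_mult p)
  qed
  have "ideal ?L (Np_ring p)"
  proof (rule idealI)
    show "ring (Np_ring p)" by (rule ring_axioms)
    show "subgroup ?L (add_monoid (Np_ring p))"
    proof
      show "?L \<subseteq> carrier (add_monoid (Np_ring p))"
        using L_carrier by (simp add: Np_ring_simps)
      show "x \<otimes>\<^bsub>add_monoid (Np_ring p)\<^esub> y \<in> ?L" if xy: "x \<in> ?L" "y \<in> ?L" for x y
      proof -
        obtain c d where "\<forall>a\<in>A. c a \<in> Np p" "x = (\<lambda>z\<in>ball 0 1. \<Sum>a\<in>A. c a z * a z)"
          "\<forall>a\<in>A. d a \<in> Np p" "y = (\<lambda>z\<in>ball 0 1. \<Sum>a\<in>A. d a z * a z)"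
          using xy by blast
        then show ?thesis
          by (intro CollectI exI[of _ "\<lambda>a. \<lambda>z\<in>ball 0 1. c a z + d a z"])
            (auto simp: Np_ring_simps fun_eq_iff sum.distrib distrib_right intro: Np_add p)
      qed
      show "\<one>\<^bsub>add_monoid (Np_ring p)\<^esub> \<in> ?L"
        by (intro CollectI exI[of _ "\<lambda>a. \<lambda>z\<in>ball 0 1. 0"])
          (auto simp: Np_ring_simps fun_eq_iff intro: Np_const p)
      show "inv\<^bsub>add_monoid (Np_ring p)\<^esub> x \<in> ?L" if x: "x \<in> ?L" for x
      proof -
        have xc: "x \<in> carrier (Np_ring p)" using x L_carrier by (auto simp: Np_ring_simps)
        have "\<ominus>\<^bsub>Np_ring p\<^esub> x = (\<ominus>\<^bsub>Np_ring p\<^esub> \<one>\<^bsub>Np_ring p\<^esub>) \<otimes>\<^bsub>Np_ring p\<^esub> x"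
          using xc by (simp add: l_minus)
        moreover have "\<ominus>\<^bsub>Np_ring p\<^esub> \<one>\<^bsub>Np_ring p\<^esub> \<in> Np p"
          using a_inv_closed[OF one_closed] by (simp add: Np_ring_simps)
        ultimately show ?thesis
          using L_mult[OF x] unfolding a_inv_def by simp
      qed
    qed
    show "g \<otimes>\<^bsub>Np_ring p\<^esub> x \<in> ?L" if "x \<in> ?L" "g \<in> carrier (Np_ring p)" for x g
      using L_mult that by (simp add: Np_ring_simps)
    show "x \<otimes>\<^bsub>Np_ring p\<^esub> g \<in> ?L" if x: "x \<in> ?L" and g: "g \<in> carrier (Np_ring p)" for x g
    proof -
      have "x \<in> carrier (Np_ring p)" using x L_carrier by (auto simp: Np_ring_simps)
      then show ?thesis
        using L_mult[OF x, of g] g m_comm[of x g] by (simp add: Np_ring_simps)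
    qed
  qed
  moreover have "A \<subseteq> ?L"
  proof
    fix a assume a: "a \<in> A"
    have eq: "a = (\<lambda>z\<in>ball 0 1. \<Sum>b\<in>A. (\<lambda>z\<in>ball 0 1. if b = a then 1 else 0) z * b z)"
    proof (rule Np_eqI)
      show "a \<in> Np p" using a A by auto
      show "(\<lambda>z\<in>ball 0 1. \<Sum>b\<in>A. (\<lambda>z\<in>ball 0 1. if b = a then 1 else 0) z * b z) \<in> Np p"
        by (rule subsetD[OF L_carrier],
            intro CollectI exI[of _ "\<lambda>b. \<lambda>z\<in>ball 0 1. if b = a then 1 else 0"] conjI ballI Np_const p refl)
      fix z :: complex assume z: "cmod z < 1"
      have "(\<Sum>b\<in>A. (\<lambda>z\<in>ball 0 1. if b = a then 1 else 0) z * b z) = (\<Sum>b\<in>A. if b = a then b z else 0)"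
        using z by (intro sum.cong) auto
      then show "a z = (\<lambda>z\<in>ball 0 1. \<Sum>b\<in>A. (\<lambda>z\<in>ball 0 1. if b = a then 1 else 0) z * b z) z"
        using z a A by simp
    qed
    show "a \<in> ?L"
      by (intro CollectI exI[of _ "\<lambda>b. \<lambda>z\<in>ball 0 1. if b = a then 1 else 0"] conjI ballI Np_const p eq)
  qed
  ultimately show "genideal (Np_ring p) A \<subseteq> ?L"
    by (rule genideal_minimal)
  show "?L \<subseteq> genideal (Np_ring p) A"
  proof clarify
    fix c assume c: "\<forall>a\<in>A. c a \<in> Np p"
    show "(\<lambda>z\<in>ball 0 1. \<Sum>a\<in>A. c a z * a z) \<in> genideal (Np_ring p) A"
      using c A genideal_self[of A] genideal_ideal[of A]
      by (intro ideal_linear_combination) (auto simp: Np_ring_simps)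
  qed
qed

text \<open>
  Generating syzygies of the combined family \<open>A\<close> and \<open>-B\<close>, restricted to their \<open>A\<close>-entries and
  evaluated against \<open>A\<close>, give generators of the intersection. The disjoint sum as index set keeps elements
  common to \<open>A\<close> and \<open>B\<close> apart.
\<close>

lemma fin_gen_Int_Np:
  assumes p: "1 \<le> p" and A: "finite A" "A \<subseteq> Np p" and B: "finite B" "B \<subseteq> Np p"
  shows "fin_gen_ideal (Np_ring p) (genideal (Np_ring p) A \<inter> genideal (Np_ring p) B)"
proof -
  have p0: "0 < p" using p by simp
  define I where "I = Sum_Type.Plus A B"
  define f where "f = case_sum (\<lambda>a. a) (\<lambda>b (z::complex). - b z :: complex)"
  have sumI: "(\<Sum>i\<in>I. u i z * f i z) = (\<Sum>a\<in>A. u (Inl a) z * a z) - (\<Sum>b\<in>B. u (Inr b) z * b z)"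
    for u :: "_ \<Rightarrow> complex \<Rightarrow> complex" and z
    unfolding I_def using A(1) B(1) by (simp add: sum.Plus f_def sum_negf)
  have fin: "finite I" using A B by (simp add: I_def)
  have hol: "\<forall>i\<in>I. f i holomorphic_on ball 0 1"
    using A(2) B(2) by (auto simp: I_def f_def Np_def intro!: holomorphic_intros)
  obtain J :: "((complex \<Rightarrow> complex) + (complex \<Rightarrow> complex)) set" and E
    where J: "finite J" and gens: "syzygy_generators p I f J E"
    using Np_syzygies_finitely_generated[OF p fin hol] by blast
  note gens = gens[unfolded syzygy_generators_def]
  note E = conjunct1[OF gens] and Ez = conjunct1[OF conjunct2[OF gens]]
    and gen = conjunct2[OF conjunct2[OF gens]]
  define g where "g j = (\<lambda>z\<in>ball 0 1. \<Sum>a\<in>A. E j (Inl a) z * a z)" for j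
  interpret cring "Np_ring p" by (rule cring_Np[OF p0])
  have EA: "E j (Inl a) \<in> Np p" if "j \<in> J" "a \<in> A" for j a
    using E that by (auto simp: I_def)
  have EB: "E j (Inr b) \<in> Np p" if "j \<in> J" "b \<in> B" for j b
    using E that by (auto simp: I_def)
  have gA: "g j \<in> genideal (Np_ring p) A" if "j \<in> J" for j
    unfolding genideal_Np[OF p0 A] g_def
    by (intro CollectI exI[of _ "\<lambda>a. E j (Inl a)"]) (use EA[OF that] in auto)
  have gB: "g j \<in> genideal (Np_ring p) B" if j: "j \<in> J" for j
  proof -
    have "g j = (\<lambda>z\<in>ball 0 1. \<Sum>b\<in>B. E j (Inr b) z * b z)"
      using Ez j unfolding sumI g_def by (auto simp: fun_eq_iff)
    then show ?thesis
      unfolding genideal_Np[OF p0 B]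
      by (intro CollectI exI[of _ "\<lambda>b. E j (Inr b)"]) (use EB[OF j] in auto)
  qed
  have idA: "ideal (genideal (Np_ring p) A) (Np_ring p)" and idB: "ideal (genideal (Np_ring p) B) (Np_ring p)"
    using A B by (auto intro!: genideal_ideal simp: Np_ring_simps)
  have gNp: "g ` J \<subseteq> Np p"
    using gA ideal.Icarr[OF idA] by (auto simp: Np_ring_simps)
  have "genideal (Np_ring p) A \<inter> genideal (Np_ring p) B = genideal (Np_ring p) (g ` J)"
  proof
    show "genideal (Np_ring p) (g ` J) \<subseteq> genideal (Np_ring p) A \<inter> genideal (Np_ring p) B"
      using gA gB by (intro genideal_minimal i_intersect idA idB) auto
    show "genideal (Np_ring p) A \<inter> genideal (Np_ring p) B \<subseteq> genideal (Np_ring p) (g ` J)"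
    proof
      fix x assume x: "x \<in> genideal (Np_ring p) A \<inter> genideal (Np_ring p) B"
      obtain c where c: "\<forall>a\<in>A. c a \<in> Np p" "x = (\<lambda>z\<in>ball 0 1. \<Sum>a\<in>A. c a z * a z)"
        using x unfolding genideal_Np[OF p0 A] by blast
      obtain d where d: "\<forall>b\<in>B. d b \<in> Np p" "x = (\<lambda>z\<in>ball 0 1. \<Sum>b\<in>B. d b z * b z)"
        using x unfolding genideal_Np[OF p0 B] by blast
      have "\<exists>h. (\<forall>j\<in>J. h j \<in> Np p) \<and>
          (\<forall>i\<in>I. \<forall>z. cmod z < 1 \<longrightarrow> case_sum c d i z = (\<Sum>j\<in>J. h j z * E j i z))"
      proof (rule gen[rule_format], intro conjI ballI allI impI)
        show "case_sum c d i \<in> Np p" if "i \<in> I" for i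
          using that c(1) d(1) by (auto simp: I_def)
        show "(\<Sum>i\<in>I. case_sum c d i z * f i z) = 0" if z: "cmod z < 1" for z
          unfolding sumI using fun_cong[OF trans[OF c(2)[symmetric] d(2)], of z] z by simp
      qed
      then obtain h where h: "\<And>j. j \<in> J \<Longrightarrow> h j \<in> Np p"
        and hc: "\<And>a z. a \<in> A \<Longrightarrow> cmod z < 1 \<Longrightarrow> c a z = (\<Sum>j\<in>J. h j z * E j (Inl a) z)"
        by (force simp: I_def)
      have "x = (\<lambda>z\<in>ball 0 1. \<Sum>j\<in>J. h j z * g j z)"
      proof (unfold c(2), rule restrict_ext)
        fix z :: complex assume "z \<in> ball 0 1"
        then have z: "cmod z < 1" by simp
        have "(\<Sum>a\<in>A. c a z * a z) = (\<Sum>a\<in>A. \<Sum>j\<in>J. h j z * (E j (Inl a) z * a z))"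
          by (intro sum.cong) (auto simp: hc[OF _ z] sum_distrib_right mult.assoc)
        also have "\<dots> = (\<Sum>j\<in>J. h j z * g j z)"
          using z by (subst sum.swap) (simp add: g_def sum_distrib_left)
        finally show "(\<Sum>a\<in>A. c a z * a z) = (\<Sum>j\<in>J. h j z * g j z)" .
      qed
      moreover have "(\<lambda>z\<in>ball 0 1. \<Sum>j\<in>J. h j z * g j z) \<in> genideal (Np_ring p) (g ` J)"
        using gNp genideal_self[of "g ` J"] genideal_ideal[of "g ` J"] h J
        by (intro ideal_linear_combination) (auto simp: Np_ring_simps)
      ultimately show "x \<in> genideal (Np_ring p) (g ` J)" by simp
    qed
  qed
  then show ?thesis
    unfolding fin_gen_ideal_def using gNp J by (intro exI[of _ "g ` J"]) (auto simp: Np_ring_simps)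
qed

theorem theorem4:
  fixes p :: real
  assumes "1 < p"
  shows "coherent_ring (Np_ring p)"
proof -
  interpret cring "Np_ring p" using assms by (intro cring_Np) auto
  show ?thesis
  proof
    fix I J assume "fin_gen_ideal (Np_ring p) I" "fin_gen_ideal (Np_ring p) J"
    then show "fin_gen_ideal (Np_ring p) (I \<inter> J)"
      using fin_gen_Int_Np[of p] assms unfolding fin_gen_ideal_def[of _ I] fin_gen_ideal_def[of _ J]
      by (auto simp: Np_ring_simps)
  qed
qed

end
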